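(* Let $n\ge1$, let $a,b,r>0$ and let $g(u)=\frac{\exp(-bu)}{(1+\exp(-au))^r}$, $u\ge0$. Let $\mathbf X\sim GML_n(\boldsymbol\mu,\mathbf\Sigma,g)$. (i) The expectation and the covariance of $\mathbf X$ are $$E(\mathbf X)=\boldsymbol\mu,\qquad Cov(\mathbf X)=\frac{\Phi_r^*\left(-1,\frac n2+1,\frac ba\right)}{2a\,\Phi_r^*\left(-1,\frac n2,\frac ba\right)}\,\mathbf\Sigma.$$ (ii) For any nonnegative integers $m_1,\dots,m_n$, with $m=\sum_{i=1}^n m_i$, the product moments of $\mathbf Y:=\mathbf\Sigma^{-\frac12}(\mathbf X-\boldsymbol\mu)$ are $$E\left(\prod_{i=1}^nY_i^{2m_i}\right)=\frac{\left(\frac1a\right)^m\Gamma\left(\frac n2+m\right)\Phi_r^*\left(-1,\frac n2+m,\frac ba\right)}{\left(\frac n2\right)^{[m]}\Gamma\left(\frac n2\right)\Phi_r^*\left(-1,\frac n2,\frac ba\right)}\prod_{i=1}^n\frac{(2m_i)!}{4^{m_i}(m_i)!},$$ where $x^{[k]}=x(x+1)\cdots(x+k-1)$ and $\Phi^*_r$ is the generalized Hurwitz-Lerch Zeta function.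
   Context: $\boldsymbol\mu\in\mathbb R^n$, $\mathbf\Sigma$ is a symmetric positive definite $n\times n$ matrix, and $\mathbf\Sigma^{-1/2}$ is the inverse of its symmetric positive definite square root. For $a,b,r>0$ and $g(u)=\frac{\exp(-bu)}{(1+\exp(-au))^r}$, $\mathbf X\sim GML_n(\boldsymbol\mu,\mathbf\Sigma,g)$ (generalized elliptically symmetric logistic distribution) means that $\mathbf X$ has density $f(\mathbf x)=d_n|\mathbf\Sigma|^{-1/2}g\big((\mathbf x-\boldsymbol\mu)^T\mathbf\Sigma^{-1}(\mathbf x-\boldsymbol\mu)\big)$ on $\mathbb R^n$, with $d_n>0$ the normalizing constant. The generalized Hurwitz-Lerch Zeta function is $$\Phi^*_{\mu}(z,s,\alpha)=\frac{1}{\Gamma(\mu)}\sum_{k=0}^{\infty}\frac{\Gamma(\mu+k)}{k!}\frac{z^k}{(k+\alpha)^s},$$ with the integral representation $$\Phi^*_{\mu}(z,s,\alpha)=\frac{1}{\Gamma(s)}\int_0^{\infty}\frac{t^{s-1}e^{-\alpha t}}{(1-ze^{-t})^{\mu}}\,dt,$$ where $\mathrm{Re}(\alpha)>0$, and $\mathrm{Re}(s)>0$ when $|z|\le 1$, $z\ne 1$ ($\mathrm{Re}(s)>1$ when $z=1$). When the series does not converge (as can happen at $z=-1$), $\Phi^*_\mu$ is understood through the integral representation. By convention $x^{[0]}=1$. *)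

theory Defs
  imports "HOL-Probability.Probability"
begin

definition pos_def_matrix :: "real^'n^'n \<Rightarrow> bool" where
  "pos_def_matrix A \<longleftrightarrow> transpose A = A \<and> (\<forall>x. x \<noteq> 0 \<longrightarrow> x \<bullet> (A *v x) > 0)"

definition matrix_sqrt :: "real^'n^'n \<Rightarrow> real^'n^'n" where
  "matrix_sqrt A = (THE S. pos_def_matrix S \<and> S ** S = A)"

definition logistic_generator :: "real \<Rightarrow> real \<Rightarrow> real \<Rightarrow> real \<Rightarrow> real" where
  "logistic_generator a b r u = exp (- b * u) / (1 + exp (- a * u)) powr r"

text \<open>\<open>GML M X \<mu> \<Sigma> g\<close>: the random vector \<open>X\<close> on \<open>M\<close> has the elliptical density with
  location \<open>\<mu>\<close>, scale matrix \<open>\<Sigma>\<close> and generator \<open>g\<close>.  If \<open>M\<close> is a probability space, the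
  density integrates to \<open>1\<close>, so \<open>d\<close> is necessarily the normalizing constant.\<close>

definition GML ::
  "'w measure \<Rightarrow> ('w \<Rightarrow> real^'n) \<Rightarrow> real^'n \<Rightarrow> real^'n^'n \<Rightarrow> (real \<Rightarrow> real) \<Rightarrow> bool" where
  "GML M X \<mu> \<Sigma> g \<longleftrightarrow>
     (\<exists>d>0. distributed M lborel X
        (\<lambda>x. ennreal (d * det \<Sigma> powr (- 1 / 2) * g ((x - \<mu>) \<bullet> (matrix_inv \<Sigma> *v (x - \<mu>))))))"

definition covariance_matrix :: "'w measure \<Rightarrow> ('w \<Rightarrow> real^'n) \<Rightarrow> real^'n^'n" where
  "covariance_matrix M X =
     (\<chi> i j. \<integral>\<omega>. (X \<omega> $ i - (\<integral>\<omega>'. X \<omega>' $ i \<partial>M)) * (X \<omega> $ j - (\<integral>\<omega>'. X \<omega>' $ j \<partial>M)) \<partial>M)"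

text \<open>The generalized Hurwitz-Lerch zeta function, for real or complex arguments: the defining
  series where it converges, and otherwise the integral representation, which is meaningful for
  \<open>Re \<alpha> > 0\<close>, \<open>Re s > 0\<close>, \<open>\<bar>z\<bar> \<le> 1\<close>, \<open>z \<noteq> 1\<close>.\<close>

definition hurwitz_lerch_term :: "'a \<Rightarrow> 'a \<Rightarrow> 'a \<Rightarrow> 'a \<Rightarrow> nat \<Rightarrow> 'a::{Gamma, ln}" where
  "hurwitz_lerch_term \<mu> z s \<alpha> k =
     Gamma (\<mu> + of_nat k) / fact k * (z ^ k / (of_nat k + \<alpha>) powr s)"

definition hurwitz_lerch_integral ::
  "'a \<Rightarrow> 'a \<Rightarrow> 'a \<Rightarrow> 'a \<Rightarrow> 'a::{Gamma, ln, second_countable_topology}" where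
  "hurwitz_lerch_integral \<mu> z s \<alpha> =
     1 / Gamma s *
     (LBINT t:{0<..}. of_real t powr (s - 1) * exp (- \<alpha> * of_real t) /
        (1 - z * exp (- of_real t)) powr \<mu>)"

definition hurwitz_lerch_zeta ::
  "'a \<Rightarrow> 'a \<Rightarrow> 'a \<Rightarrow> 'a \<Rightarrow> 'a::{Gamma, ln, second_countable_topology}" where
  "hurwitz_lerch_zeta \<mu> z s \<alpha> =
     (if summable (hurwitz_lerch_term \<mu> z s \<alpha>)
      then 1 / Gamma \<mu> * (\<Sum>k. hurwitz_lerch_term \<mu> z s \<alpha> k)
      else hurwitz_lerch_integral \<mu> z s \<alpha>)"

end

theory Submission
  imports Defs
begin

text \<open>With \<open>S = \<Sigma>\<^sup>1\<^sup>/\<^sup>2\<close>, the vector \<open>Y = S\<^sup>-\<^sup>1 (X - \<mu>)\<close> has density \<open>K g(\<bar>y\<bar>\<^sup>2)\<close>; the Jacobian of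
  \<open>S\<close> is absorbed by the constant \<open>K\<close>, which is fixed by total mass one. The measure with density
  \<open>\<Prod>\<^sub>i y\<^sub>i\<^bsup>2k\<^sub>i\<^esup>\<close> is homogeneous, so its image under \<open>y \<mapsto> \<bar>y\<bar>\<^sup>2\<close> is a multiple of
  \<open>u\<^bsup>n/2+m-1\<^esup> du\<close>, with the multiple read off from Gaussian moments. Even moments of \<open>Y\<close> are
  therefore quotients of the integrals \<open>\<integral>u\<^bsup>p-1\<^esup> g(u) du\<close>, which the substitution \<open>u = t/a\<close> turns into
  \<open>a\<^bsup>-p\<^esup> \<Gamma>(p) \<Phi>(-1, p, b/a)\<close>. Reflections of the coordinates kill the means and the mixed second
  moments of \<open>Y\<close>, and \<open>X = \<mu> + S Y\<close> gives the mean and the covariance of \<open>X\<close>.\<close>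

section \<open>Linear images of Lebesgue measure\<close>

text \<open>The delicate point is the value of the zeta function at z = -1. Its terms have size
  k^(r-1-s), so the series converges absolutely only for s > r and diverges for s \<le> r - 1,
  whereas s = n/2 + m is compared with an arbitrary r > 0. Where the series diverges, the definition
  is the integral itself. Where it converges, possibly only conditionally, termwise integration is
  available only strictly inside the unit disc, and Abel's limit theorem carries the identity to the
  boundary. Even moments are computed as extended nonnegative integrals, so that integrability is
  obtained together with the value, and neither det \<Sigma> nor the area of a sphere is ever
  evaluated. The case of exponents 0 also shows that the zeta value in the denominators does not
  vanish. The root of \<Sigma> is given by a definite description, hence the need for both existence
  and uniqueness.\<close>

lemma nn_integral_lborel_shift:
  fixes f :: "'a::euclidean_space \<Rightarrow> ennreal"
  assumes [measurable]: "f \<in> borel_measurable borel"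
  shows "(\<integral>\<^sup>+x. f (t + x) \<partial>lborel) = (\<integral>\<^sup>+x. f x \<partial>lborel)"
proof -
  have "(\<integral>\<^sup>+x. f x \<partial>lborel) = (\<integral>\<^sup>+x. f x \<partial>(distr lborel borel ((+) t)))"
    by (simp add: lborel_distr_plus)
  then show ?thesis
    by (simp add: nn_integral_distr)
qed

text \<open>The Jacobian is the product of the \<open>\<bar>c j\<bar>\<close>, hence 1. All signs -1
  give invariance under \<open>x \<mapsto> - x\<close>; arbitrary signs serve the coordinate
  reflections that make odd moments vanish.\<close>

lemma nn_integral_lborel_signs:
  fixes f :: "'a::euclidean_space \<Rightarrow> ennreal"
  assumes [measurable]: "f \<in> borel_measurable borel"
    and c: "\<And>j. j \<in> Basis \<Longrightarrow> \<bar>c j\<bar> = 1"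
  shows "(\<integral>\<^sup>+x. f (\<Sum>j\<in>Basis. (c j * (x \<bullet> j)) *\<^sub>R j) \<partial>lborel) = (\<integral>\<^sup>+x. f x \<partial>lborel)"
proof -
  have "lborel = density (distr lborel borel (\<lambda>x. 0 + (\<Sum>j\<in>Basis. (c j * (x \<bullet> j)) *\<^sub>R j :: 'a)))
      (\<lambda>_. (\<Prod>j\<in>Basis. \<bar>c j\<bar>))"
    by (rule lborel_affine_euclidean) (use c in fastforce)
  also have "\<dots> = distr lborel borel (\<lambda>x. \<Sum>j\<in>Basis. (c j * (x \<bullet> j)) *\<^sub>R j :: 'a)"
    using c by (simp add: density_1)
  finally have *: "lborel = distr lborel borel (\<lambda>x. \<Sum>j\<in>Basis. (c j * (x \<bullet> j)) *\<^sub>R j :: 'a)" .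
  show ?thesis
    by (subst (2) *) (simp add: nn_integral_distr)
qed

lemma nn_integral_lborel_uminus:
  fixes f :: "'a::euclidean_space \<Rightarrow> ennreal"
  assumes "f \<in> borel_measurable borel"
  shows "(\<integral>\<^sup>+x. f (- x) \<partial>lborel) = (\<integral>\<^sup>+x. f x \<partial>lborel)"
  using nn_integral_lborel_signs[OF assms, of "\<lambda>_. -1"]
  by (simp add: sum_negf euclidean_representation)

lemma emeasure_lborel_open_pos:
  fixes S :: "'a::euclidean_space set"
  assumes "open S" "S \<noteq> {}"
  shows "emeasure lborel S > 0"
proof -
  have "S \<notin> null_sets lborel"
    using open_not_negligible[OF assms] by (metis negligible_iff_null_sets null_sets_completionI)
  then show ?thesis
    using assms by (simp add: null_sets_def zero_less_iff_neq_zero)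
qed

text \<open>The library's change of variables by a determinant needs a well-ordered index type. Since
  \<open>T\<close> carries Lebesgue measure \<open>\<lambda>\<close> to a translation-invariant measure \<open>\<nu>\<close>, Fubini gives
  \<open>\<integral>f d\<lambda> \<cdot> \<integral>h d\<nu> = \<integral>f d\<nu> \<cdot> \<integral>h d\<lambda>\<close>, here with the indicator \<open>h\<close> of the unit ball.\<close>

lemma nn_integral_lborel_linear:
  fixes T :: "'a::euclidean_space \<Rightarrow> 'a"
  assumes T: "linear T" "bij T"
  obtains c :: real where "c > 0"
    "\<And>f. f \<in> borel_measurable borel \<Longrightarrow> (\<integral>\<^sup>+x. f (T x) \<partial>lborel) = ennreal c * (\<integral>\<^sup>+x. f x \<partial>lborel)"
proof -
  let ?h = "indicator (ball 0 1) :: 'a \<Rightarrow> ennreal"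
  have contT: "continuous_on UNIV T"
    using T by (simp add: linear_continuous_on linear_conv_bounded_linear)
  have [measurable]: "T \<in> borel_measurable borel"
    using contT by (rule borel_measurable_continuous_onI)
  have h [measurable]: "?h \<in> borel_measurable borel"
    by (intro borel_measurable_indicator) simp
  define U where "U = inv T"
  have TU: "T (U x) = x" and UT: "U (T x) = x" for x
    using T by (simp_all add: U_def bij_is_surj surj_f_inv_f bij_is_inj)
  have linU: "linear U"
    unfolding U_def using T by (intro inj_linear_imp_inv_linear) (simp_all add: bij_is_inj)
  have vim: "T -` ball 0 1 = U ` ball 0 1"
    unfolding U_def using T(2) by (rule bij_vimage_eq_inv_image)
  define I where "I = emeasure lborel (ball (0::'a) 1)"
  define J where "J = emeasure lborel (T -` ball (0::'a) 1)"
  have I: "I = (\<integral>\<^sup>+x. ?h x \<partial>lborel)" by (simp add: I_def)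
  have "open (T -` ball (0::'a) 1)"
    using contT by (simp add: open_vimage)
  moreover have "0 \<in> T -` ball (0::'a) 1" using T(1) by (simp add: linear_0)
  ultimately have Jpos: "J > 0"
    unfolding J_def by (intro emeasure_lborel_open_pos) auto
  have "bounded (T -` ball (0::'a) 1)"
    unfolding vim using linU by (intro bounded_linear_image) (auto simp: linear_conv_bounded_linear)
  then have Jfin: "J < \<infinity>"
    unfolding J_def by (rule emeasure_bounded_finite)
  have Ipos: "I > 0"
    unfolding I_def by (intro emeasure_lborel_open_pos) auto
  have Ifin: "I < \<infinity>"
    unfolding I_def by (rule emeasure_bounded_finite) simp
  \<comment> \<open>\<open>c\<close> compares the volume of the preimage of the unit ball with that
    of the ball, so it equals 1 / |det T|. Both volumes are positive because the sets are open and
    nonempty, and finite because they are bounded, which makes the later division by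
    \<open>I\<close> legitimate.\<close>
  define c where "c = enn2real J / enn2real I"
  have "c > 0"
    using Jpos Jfin Ipos Ifin by (simp add: c_def enn2real_positive_iff)
  moreover have "(\<integral>\<^sup>+x. f (T x) \<partial>lborel) = ennreal c * (\<integral>\<^sup>+x. f x \<partial>lborel)"
    if [measurable]: "f \<in> borel_measurable borel" for f
  proof -
    have J: "J = (\<integral>\<^sup>+x. ?h (T x) \<partial>lborel)"
    proof -
      have "(\<integral>\<^sup>+x. ?h (T x) \<partial>lborel) = (\<integral>\<^sup>+x. indicator (T -` ball 0 1) x \<partial>lborel)"
        by (intro nn_integral_cong) (simp add: indicator_def)
      then show ?thesis
        unfolding J_def using \<open>open (T -` ball (0::'a) 1)\<close> by simp
    qed
    have "(\<integral>\<^sup>+y. f y \<partial>lborel) * J = (\<integral>\<^sup>+x. (\<integral>\<^sup>+y. f y \<partial>lborel) * ?h (T x) \<partial>lborel)"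
      unfolding J by (rule nn_integral_cmult[symmetric]) measurable
    also have "\<dots> = (\<integral>\<^sup>+x. (\<integral>\<^sup>+y. f (T x + y) \<partial>lborel) * ?h (T x) \<partial>lborel)"
      by (simp add: nn_integral_lborel_shift)
    also have "\<dots> = (\<integral>\<^sup>+x. \<integral>\<^sup>+y. f (T x + y) * ?h (T x) \<partial>lborel \<partial>lborel)"
      by (simp add: nn_integral_multc)
    also have "\<dots> = (\<integral>\<^sup>+y. \<integral>\<^sup>+x. f (T x + y) * ?h (T x) \<partial>lborel \<partial>lborel)"
      by (rule lborel_pair.Fubini') measurable
    \<comment> \<open>For fixed \<open>y\<close>, translating \<open>x\<close> by \<open>U y\<close>
      turns \<open>T x\<close> into \<open>T x + y\<close>. This is the translation invariance of
      the image measure.\<close>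
    also have "\<dots> = (\<integral>\<^sup>+y. \<integral>\<^sup>+x. f (T x) * ?h (T x - y) \<partial>lborel \<partial>lborel)"
    proof (rule nn_integral_cong)
      fix y
      show "(\<integral>\<^sup>+x. f (T x + y) * ?h (T x) \<partial>lborel) = (\<integral>\<^sup>+x. f (T x) * ?h (T x - y) \<partial>lborel)"
        using nn_integral_lborel_shift[of "\<lambda>x. f (T x) * ?h (T x - y)" "U y"] T(1) TU
        by (simp add: linear_add add.commute)
    qed
    also have "\<dots> = (\<integral>\<^sup>+x. \<integral>\<^sup>+y. f (T x) * ?h (T x - y) \<partial>lborel \<partial>lborel)"
      by (rule lborel_pair.Fubini') measurable
    \<comment> \<open>As a function of \<open>y\<close>, the indicator is that of the unit ball
      around \<open>T x\<close>, whose volume \<open>I\<close> does not depend on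
      \<open>x\<close>.\<close>
    also have "\<dots> = (\<integral>\<^sup>+x. f (T x) * I \<partial>lborel)"
    proof (rule nn_integral_cong)
      fix x
      have "(\<integral>\<^sup>+y. ?h (T x - y) \<partial>lborel) = I"
        using nn_integral_lborel_uminus[of "\<lambda>y. ?h (T x + y)"] nn_integral_lborel_shift[of ?h "T x"]
        by (simp add: I)
      then show "(\<integral>\<^sup>+y. f (T x) * ?h (T x - y) \<partial>lborel) = f (T x) * I"
        by (simp add: nn_integral_cmult)
    qed
    also have "\<dots> = (\<integral>\<^sup>+x. f (T x) \<partial>lborel) * I"
      by (simp add: nn_integral_multc)
    finally have "(\<integral>\<^sup>+x. f (T x) \<partial>lborel) = (\<integral>\<^sup>+y. f y \<partial>lborel) * J / I"
      using Ipos Ifin by (simp add: ennreal_mult_divide_eq)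
    also have "\<dots> = (J / I) * (\<integral>\<^sup>+y. f y \<partial>lborel)"
      by (simp add: ennreal_times_divide mult.commute)
    also have "J / I = ennreal c"
      using Jpos Jfin Ipos Ifin
      by (cases J; cases I) (auto simp: c_def divide_ennreal)
    finally show ?thesis .
  qed
  ultimately show ?thesis using that by blast
qed

section \<open>Square roots of positive definite matrices\<close>

text \<open>A self-adjoint map attains the maximum of its Rayleigh quotient on an invariant subspace at
  an eigenvector.\<close>

lemma selfadjoint_eigenvector:
  fixes f :: "'a::euclidean_space \<Rightarrow> 'a"
  assumes f: "linear f" and sa: "\<And>x y. f x \<bullet> y = x \<bullet> f y"
    and V: "subspace V" "f ` V \<subseteq> V" "V \<noteq> {0}"
  obtains v l where "v \<in> V" "norm v = 1" "f v = l *\<^sub>R v"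
proof -
  let ?K = "V \<inter> sphere 0 1"
  obtain u where u: "u \<in> V" "u \<noteq> 0"
    using V subspace_0 by blast
  have "u /\<^sub>R norm u \<in> ?K"
    using u V(1) by (simp add: subspace_scale)
  moreover have "compact ?K"
    using V(1) by (intro closed_Int_compact closed_subspace) auto
  moreover have "continuous_on ?K (\<lambda>x. x \<bullet> f x)"
    by (intro continuous_intros linear_continuous_on f[unfolded linear_conv_bounded_linear])
  ultimately obtain v where v: "v \<in> V" "norm v = 1"
    and max: "\<And>x. x \<in> V \<Longrightarrow> norm x = 1 \<Longrightarrow> x \<bullet> f x \<le> v \<bullet> f v"
    using continuous_attains_sup[of ?K "\<lambda>x. x \<bullet> f x"]
    by (metis IntE IntI empty_iff mem_sphere_0)
  define l where "l = v \<bullet> f v"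
  have q: "0 \<le> l * (x \<bullet> x) - x \<bullet> f x" if "x \<in> V" for x
  proof (cases "x = 0")
    case False
    let ?y = "x /\<^sub>R norm x"
    have "?y \<bullet> f ?y \<le> l"
      unfolding l_def using that False V(1) by (intro max) (auto simp: subspace_scale)
    moreover have "?y \<bullet> f ?y = (x \<bullet> f x) / (x \<bullet> x)"
      using f by (simp add: linear_scale divide_simps dot_square_norm power2_eq_square)
    ultimately show ?thesis
      using False by (simp add: divide_le_eq)
  qed (use f in \<open>simp add: linear_0\<close>)
  \<comment> \<open>\<open>w\<close> is the residual of the eigenvalue equation. The form in
    \<open>q\<close> vanishes at \<open>v\<close> and has derivative
    \<open>2 * (w \<bullet> w)\<close> there in direction \<open>w\<close>, so a small step along
    \<open>- w\<close> would make it negative unless \<open>w = 0\<close>.\<close>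
  define w where "w = l *\<^sub>R v - f v"
  have w: "w \<in> V"
    unfolding w_def using v V by (intro subspace_diff subspace_scale) auto
  have vv: "v \<bullet> v = 1" using v by (simp add: dot_square_norm)
  have "w \<bullet> w = 0"
  proof (rule ccontr)
    assume ne: "w \<bullet> w \<noteq> 0"
    define Q where "Q = l * (w \<bullet> w) - w \<bullet> f w"
    have Q: "Q \<ge> 0" unfolding Q_def by (rule q[OF w])
    have *: "0 \<le> t * (2 * (w \<bullet> w) + t * Q)" for t
    proof -
      have "0 \<le> l * ((v + t *\<^sub>R w) \<bullet> (v + t *\<^sub>R w)) - (v + t *\<^sub>R w) \<bullet> f (v + t *\<^sub>R w)"
        using v w V(1) by (intro q subspace_add subspace_scale)
      also have "\<dots> = t * (2 * (l * (v \<bullet> w) - f v \<bullet> w) + t * Q)"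
        using f sa[of v w] vv
        by (simp add: Q_def linear_add linear_scale inner_add inner_diff l_def algebra_simps
            inner_commute)
      also have "l * (v \<bullet> w) - f v \<bullet> w = w \<bullet> w"
        unfolding w_def[THEN arg_cong, of "\<lambda>z. z \<bullet> w"] by (simp add: inner_diff_left)
      finally show ?thesis .
    qed
    \<comment> \<open>Any small negative \<open>t\<close> works. This one keeps \<open>t * Q\<close>
      above \<open>- (w \<bullet> w)\<close>, and the summand 1 covers \<open>Q = 0\<close>.\<close>
    define t where "t = - (w \<bullet> w) / (Q + 1)"
    have "t < 0" using ne Q by (simp add: t_def divide_neg_pos)
    moreover have "2 * (w \<bullet> w) + t * Q > 0"
    proof -
      have "t * Q = - (w \<bullet> w) * (Q / (Q + 1))" by (simp add: t_def)
      moreover have "(w \<bullet> w) * (Q / (Q + 1)) \<le> (w \<bullet> w) * 1"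
        using Q by (intro mult_left_mono) auto
      moreover have "w \<bullet> w > 0" using ne by simp
      ultimately show ?thesis by linarith
    qed
    ultimately have "t * (2 * (w \<bullet> w) + t * Q) < 0" by (rule mult_neg_pos)
    with *[of t] show False by simp
  qed
  then have "f v = l *\<^sub>R v" by (simp add: w_def)
  with v that show ?thesis by blast
qed

text \<open>An orthonormal set of eigenvectors of maximal cardinality must span: its orthogonal
  complement is invariant by self-adjointness, and a unit eigenvector found there would enlarge the
  set. Maximality replaces an induction on the dimension.\<close>

theorem selfadjoint_orthonormal_eigenbasis:
  fixes f :: "'a::euclidean_space \<Rightarrow> 'a"
  assumes f: "linear f" and sa: "\<And>x y. f x \<bullet> y = x \<bullet> f y"
  obtains B l where "finite B" "pairwise orthogonal B" "\<And>b. b \<in> B \<Longrightarrow> norm b = 1"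
    "span B = UNIV" "\<And>b. b \<in> B \<Longrightarrow> f b = l b *\<^sub>R b"
proof -
  define P where "P B \<longleftrightarrow> pairwise orthogonal B \<and> (\<forall>b\<in>B. norm b = 1 \<and> (\<exists>l. f b = l *\<^sub>R b))" for B
  have ind: "independent B" if "P B" for B
    using that by (intro pairwise_orthogonal_independent) (auto simp: P_def)
  have "P {}" by (simp add: P_def)
  moreover have "\<forall>B. P B \<longrightarrow> card B < Suc DIM('a)"
    using ind independent_bound by (meson le_imp_less_Suc)
  ultimately obtain B where B: "P B" and max: "\<And>C. P C \<Longrightarrow> card C \<le> card B"
    using ex_has_greatest_nat[of P "{}" card "Suc DIM('a)"] by blast
  have fin: "finite B"
    using ind[OF B] by (rule independent_imp_finite)
  let ?V = "{x. \<forall>b\<in>B. orthogonal b x}"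
  have "?V = {0}"
  proof (rule ccontr)
    assume ne: "?V \<noteq> {0}"
    have inv: "f ` ?V \<subseteq> ?V"
    proof safe
      fix x b assume x: "\<forall>b\<in>B. orthogonal b x" and b: "b \<in> B"
      obtain l where "f b = l *\<^sub>R b" using B b by (auto simp: P_def)
      then show "orthogonal b (f x)"
        using x b sa[of b x] by (simp add: orthogonal_def)
    qed
    obtain v l where v: "v \<in> ?V" "norm v = 1" "f v = l *\<^sub>R v"
      using selfadjoint_eigenvector[OF f sa subspace_orthogonal_to_vectors inv ne] by blast
    have "v \<notin> B" using v by (auto simp: orthogonal_def)
    moreover have "P (insert v B)"
      using B v by (auto simp: P_def pairwise_insert orthogonal_commute)
    ultimately show False
      using max[of "insert v B"] fin by simp
  qed
  have "x \<in> span B" for x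
  proof -
    obtain y z where yz: "y \<in> span B" "\<And>w. w \<in> span B \<Longrightarrow> orthogonal z w" "x = y + z"
      using orthogonal_subspace_decomp_exists[of B x] by blast
    have "z \<in> ?V" using yz(2) span_base orthogonal_commute by blast
    then have "z = 0" using \<open>?V = {0}\<close> by blast
    then show ?thesis using yz by simp
  qed
  then have "span B = UNIV" by blast
  moreover obtain l where "\<And>b. b \<in> B \<Longrightarrow> f b = l b *\<^sub>R b"
    using B unfolding P_def by metis
  ultimately show ?thesis
    using that[of B l] fin B by (auto simp: P_def)
qed

lemma orthonormal_expansion:
  fixes B :: "'a::euclidean_space set"
  assumes "finite B" "pairwise orthogonal B" "\<And>b. b \<in> B \<Longrightarrow> norm b = 1" "span B = UNIV"
  shows "(\<Sum>b\<in>B. (x \<bullet> b) *\<^sub>R b) = x"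
  by (rule orthonormal_basis_expand) (use assms in auto)

section \<open>Existence and uniqueness of the positive definite root\<close>

lemma pos_def_selfadjoint:
  assumes "pos_def_matrix A"
  shows "(A *v x) \<bullet> y = x \<bullet> (A *v y)"
  using assms by (metis pos_def_matrix_def dot_lmul_matrix transpose_matrix_vector inner_commute)

lemma pos_def_invertible:
  fixes A :: "real^'n^'n"
  assumes "pos_def_matrix A"
  shows "invertible A"
proof -
  have "x = 0" if "A *v x = 0" for x
    using assms that by (force simp: pos_def_matrix_def)
  then show ?thesis
    by (simp add: invertible_left_inverse matrix_left_invertible_ker)
qed

text \<open>The root multiplies each vector of an orthonormal eigenbasis of \<open>A\<close> by the
  square root of its eigenvalue; positive definiteness makes these eigenvalues positive.\<close>

lemma pos_def_sqrt_exists: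
  fixes A :: "real^'n^'n"
  assumes A: "pos_def_matrix A"
  obtains S where "pos_def_matrix S" "S ** S = A"
proof -
  obtain B l where B: "finite B" "pairwise orthogonal B" "\<And>b. b \<in> B \<Longrightarrow> norm b = 1"
    "span B = UNIV" and l: "\<And>b. b \<in> B \<Longrightarrow> A *v b = l b *\<^sub>R b"
    using selfadjoint_orthonormal_eigenbasis[OF matrix_vector_mul_linear pos_def_selfadjoint[OF A]]
    by blast
  note expand = orthonormal_expansion[OF B]
  have lpos: "l b > 0" if "b \<in> B" for b
  proof -
    have "b \<noteq> 0" using B(3)[OF that] by auto
    then have "b \<bullet> (A *v b) > 0" using A by (auto simp: pos_def_matrix_def)
    then show ?thesis using B(3)[OF that] l[OF that] by (simp add: dot_square_norm)
  qed
  define s where "s x = (\<Sum>b\<in>B. (sqrt (l b) * (x \<bullet> b)) *\<^sub>R b)" for x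
  have lin: "linear s"
    unfolding s_def by (auto intro!: linearI simp: inner_add_left distrib_left scaleR_add_left
        sum.distrib scaleR_sum_right mult_ac)
  \<comment> \<open>The formula is symmetric in \<open>x\<close> and \<open>y\<close>, and at
    \<open>y = x\<close> it is a sum of nonnegative terms, not all zero when
    \<open>x \<noteq> 0\<close>. It thus yields both the symmetry and the positive definiteness of
    the matrix.\<close>
  have s_inner: "s x \<bullet> y = (\<Sum>b\<in>B. sqrt (l b) * (x \<bullet> b) * (y \<bullet> b))" for x y
    unfolding s_def inner_sum_left by (simp add: inner_commute)
  have sb: "s b = sqrt (l b) *\<^sub>R b" if "b \<in> B" for b
  proof -
    have "s b = (\<Sum>c\<in>B. if c = b then sqrt (l b) *\<^sub>R b else 0)"
      unfolding s_def using B(2,3) that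
      by (intro sum.cong) (auto simp: pairwise_def orthogonal_def dot_square_norm)
    then show ?thesis using that B(1) by simp
  qed
  define S where "S = matrix s"
  have S: "S *v x = s x" for x
    unfolding S_def using lin by (simp add: matrix_works)
  have "transpose S = S"
  proof (rule matrix_eq[THEN iffD2], rule allI)
    fix x
    have "(transpose S *v x) \<bullet> y = (S *v x) \<bullet> y" for y
    proof -
      have "(transpose S *v x) \<bullet> y = x \<bullet> (S *v y)"
        by (metis dot_lmul_matrix transpose_matrix_vector)
      also have "\<dots> = (S *v x) \<bullet> y"
        unfolding S inner_commute[of x "s y"] s_inner by (simp add: mult_ac)
      finally show ?thesis .
    qed
    then show "transpose S *v x = S *v x"
      by (metis vector_eq_rdot)
  qed
  moreover have "x \<bullet> (S *v x) > 0" if "x \<noteq> 0" for x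
  proof -
    have "x \<bullet> (S *v x) = (\<Sum>b\<in>B. sqrt (l b) * (x \<bullet> b)\<^sup>2)"
      by (simp add: S inner_commute[of x "s x"] s_inner power2_eq_square mult.assoc)
    moreover have "\<exists>b\<in>B. x \<bullet> b \<noteq> 0"
      using expand[of x] that by (metis (no_types, lifting) scaleR_zero_left sum.neutral)
    then have "(\<Sum>b\<in>B. sqrt (l b) * (x \<bullet> b)\<^sup>2) > 0"
      using lpos B(1) by (auto intro!: sum_pos2 simp: less_imp_le)
    ultimately show ?thesis by simp
  qed
  moreover have "S ** S = A"
  proof (rule matrix_eq[THEN iffD2], rule allI)
    fix x
    have "(S ** S) *v x = s (s x)"
      by (simp add: S matrix_vector_mul_assoc[symmetric])
    also have "\<dots> = (\<Sum>b\<in>B. (sqrt (l b) * (x \<bullet> b)) *\<^sub>R s b)"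
      by (simp add: s_def[of x] linear_sum[OF lin] linear_scale[OF lin])
    also have "\<dots> = (\<Sum>b\<in>B. (x \<bullet> b) *\<^sub>R (A *v b))"
    proof (rule sum.cong)
      fix b assume b: "b \<in> B"
      have "sqrt (l b) * (x \<bullet> b) * sqrt (l b) = (x \<bullet> b) * l b"
        using lpos[OF b] by (simp add: mult_ac)
      then show "(sqrt (l b) * (x \<bullet> b)) *\<^sub>R s b = (x \<bullet> b) *\<^sub>R (A *v b)"
        using b by (simp add: sb l)
    qed simp
    also have "\<dots> = A *v (\<Sum>b\<in>B. (x \<bullet> b) *\<^sub>R b)"
      by (simp add: linear_sum[OF matrix_vector_mul_linear] matrix_vector_mult_scaleR)
    finally show "(S ** S) *v x = A *v x" by (simp add: expand)
  qed
  ultimately show ?thesis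
    using that[of S] by (simp add: pos_def_matrix_def)
qed

text \<open>An eigenvector \<open>v\<close> of \<open>D = S - T\<close> has eigenvalue \<open>0\<close>, because
  \<open>S D + D T = S\<^sup>2 - T\<^sup>2 = 0\<close> gives \<open>l * (v \<bullet> S v + v \<bullet> T v) = 0\<close>.\<close>

lemma pos_def_sqrt_unique:
  fixes S T :: "real^'n^'n"
  assumes S: "pos_def_matrix S" and T: "pos_def_matrix T" and eq: "S ** S = T ** T"
  shows "S = T"
proof -
  define D where "D = S - T"
  have sa: "(D *v x) \<bullet> y = x \<bullet> (D *v y)" for x y
    using pos_def_selfadjoint[OF S] pos_def_selfadjoint[OF T]
    by (simp add: D_def matrix_vector_mult_diff_rdistrib inner_diff)
  obtain B l where B: "finite B" "pairwise orthogonal B" "\<And>b. b \<in> B \<Longrightarrow> norm b = 1"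
    "span B = UNIV" and l: "\<And>b. b \<in> B \<Longrightarrow> D *v b = l b *\<^sub>R b"
    using selfadjoint_orthonormal_eigenbasis[OF matrix_vector_mul_linear sa] by blast
  have "D *v b = 0" if b: "b \<in> B" for b
  proof -
    have "b \<noteq> 0" using B(3)[OF b] by auto
    then have pos: "b \<bullet> (S *v b) + b \<bullet> (T *v b) > 0"
      using S T by (simp add: pos_def_matrix_def add_pos_pos)
    have "S *v (D *v b) + D *v (T *v b) = (S ** S) *v b - (T ** T) *v b"
      by (simp add: D_def matrix_vector_mult_diff_rdistrib matrix_vector_mult_diff_distrib
          flip: matrix_vector_mul_assoc)
    then have "b \<bullet> (S *v (D *v b)) + b \<bullet> (D *v (T *v b)) = 0"
      by (simp add: eq flip: inner_add_right)
    then have "l b * (b \<bullet> (S *v b) + b \<bullet> (T *v b)) = 0"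
      by (simp add: sa[symmetric] l[OF b] matrix_vector_mult_scaleR distrib_left)
    with pos have "l b = 0" by simp
    then show ?thesis by (simp add: l[OF b])
  qed
  then have "D *v (\<Sum>b\<in>B. (x \<bullet> b) *\<^sub>R b) = 0" for x
    by (simp add: linear_sum[OF matrix_vector_mul_linear] matrix_vector_mult_scaleR)
  then have "D *v x = 0 *v x" for x
    by (simp add: orthonormal_expansion[OF B])
  then show ?thesis
    by (simp add: D_def matrix_eq matrix_vector_mult_diff_rdistrib)
qed

lemma matrix_sqrt:
  fixes A :: "real^'n^'n"
  assumes "pos_def_matrix A"
  shows "pos_def_matrix (matrix_sqrt A)" "matrix_sqrt A ** matrix_sqrt A = A"
proof -
  obtain S where "pos_def_matrix S" "S ** S = A"
    using pos_def_sqrt_exists[OF assms] .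
  then have "pos_def_matrix (matrix_sqrt A) \<and> matrix_sqrt A ** matrix_sqrt A = A"
    unfolding matrix_sqrt_def by (rule_tac theI) (auto intro: pos_def_sqrt_unique)
  then show "pos_def_matrix (matrix_sqrt A)" "matrix_sqrt A ** matrix_sqrt A = A"
    by auto
qed

section \<open>The Hurwitz-Lerch zeta function as an integral\<close>

text \<open>Summation by parts turns the difference into
  \<open>(1 - x) * (\<Sum>n. s n * x ^ n)\<close>, where \<open>s n\<close> is the error of the
  partial sum up to \<open>n\<close>. The tail is small because \<open>s n\<close> tends to 0, and
  the finitely many other terms are killed by the factor \<open>1 - x\<close>.\<close>

lemma Abel_limit:
  fixes a :: "nat \<Rightarrow> real"
  assumes a: "summable a"
  shows "((\<lambda>x. \<Sum>n. a n * x ^ n) \<longlongrightarrow> (\<Sum>n. a n)) (at_left 1)"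
proof -
  define s where "s n = (\<Sum>k\<le>n. a k) - (\<Sum>n. a n)" for n
  have s0: "s \<longlonglongrightarrow> 0"
    unfolding s_def using summable_LIMSEQ'[OF a] by (rule LIM_zero)
  have "Bseq s"
    using s0 convergentI convergent_imp_Bseq by blast
  then obtain M where M: "\<And>n. \<bar>s n\<bar> \<le> M"
    unfolding Bseq_def real_norm_def by blast
  have eq: "(\<Sum>n. a n * x ^ n) - (\<Sum>n. a n) = (1 - x) * (\<Sum>n. s n * x ^ n)"
    and sm: "summable (\<lambda>n. \<bar>s n\<bar> * x ^ n)" if x: "0 < x" "x < 1" for x
  proof -
    have geo: "summable (\<lambda>n. M * x ^ n)"
      using x by (intro summable_mult summable_geometric) auto
    show sm: "summable (\<lambda>n. \<bar>s n\<bar> * x ^ n)"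
    proof (rule summable_comparison_test'[OF geo, of 0])
      fix n :: nat
      have "\<bar>s n\<bar> * x ^ n \<le> M * x ^ n"
        using x by (intro mult_right_mono M) simp
      then show "norm (\<bar>s n\<bar> * x ^ n) \<le> M * x ^ n"
        using x by (simp add: abs_mult)
    qed
    then have sms: "summable (\<lambda>n. s n * x ^ n)"
      by - (rule summable_rabs_cancel, use x in \<open>simp add: abs_mult\<close>)
    define c where "c = (\<Sum>n. a n)"
    \<comment> \<open>Consecutive errors differ by \<open>a n\<close>, except at index 0, where
      \<open>s 0 = a 0 - c\<close>. This exceptional \<open>c\<close> is the limit that ends up on
      the left-hand side.\<close>
    have "(\<lambda>n. s n * x ^ n - x * (if n = 0 then 0 else s (n - 1) * x ^ (n - 1)))
        sums ((\<Sum>n. s n * x ^ n) - x * (\<Sum>n. s n * x ^ n))"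
    proof (intro sums_diff sums_mult)
      show "(\<lambda>n. if n = 0 then 0 else s (n - 1) * x ^ (n - 1)) sums (\<Sum>n. s n * x ^ n)"
        using sums_Suc[of "\<lambda>n. if n = 0 then 0 else s (n - 1) * x ^ (n - 1)" "\<Sum>n. s n * x ^ n"] sms
        by (simp add: summable_sums)
    qed (use sms in \<open>simp add: summable_sums\<close>)
    also have "(\<lambda>n. s n * x ^ n - x * (if n = 0 then 0 else s (n - 1) * x ^ (n - 1)))
        = (\<lambda>n. a n * x ^ n - (if n = 0 then c else 0))"
    proof
      fix n
      show "s n * x ^ n - x * (if n = 0 then 0 else s (n - 1) * x ^ (n - 1))
        = a n * x ^ n - (if n = 0 then c else 0)"
        by (cases n) (simp_all add: s_def c_def algebra_simps)
    qed
    finally have "(\<lambda>n. a n * x ^ n - (if n = 0 then c else 0) + (if n = 0 then c else 0))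
        sums ((\<Sum>n. s n * x ^ n) - x * (\<Sum>n. s n * x ^ n) + c)"
      by (rule sums_add) (rule sums_single)
    then show "(\<Sum>n. a n * x ^ n) - (\<Sum>n. a n) = (1 - x) * (\<Sum>n. s n * x ^ n)"
      by (simp add: sums_iff c_def algebra_simps)
  qed
  have "((\<lambda>x. (\<Sum>n. a n * x ^ n) - (\<Sum>n. a n)) \<longlongrightarrow> 0) (at_left 1)"
  proof (rule tendstoI)
    fix e :: real assume e: "e > 0"
    then obtain N where N: "\<And>n. n \<ge> N \<Longrightarrow> \<bar>s n\<bar> < e / 2"
      using LIMSEQ_D[OF s0, of "e / 2"] by auto
    define C where "C = (\<Sum>n<N. \<bar>s n\<bar>)"
    have C: "C \<ge> 0" by (simp add: C_def sum_nonneg)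
    \<comment> \<open>The bound 1/2 keeps \<open>x\<close> positive. The other one makes
      \<open>(1 - x) * (C + 1)\<close> less than \<open>e / 2\<close>, where the summand 1 avoids a
      division by zero when \<open>C = 0\<close>.\<close>
    define \<delta> where "\<delta> = min (1/2) (e / (2 * (C + 1)))"
    have "\<delta> > 0" using e C by (simp add: \<delta>_def)
    have "eventually (\<lambda>x. x \<in> {1 - \<delta><..<1}) (at_left (1::real))"
      using \<open>\<delta> > 0\<close> by (intro eventually_at_leftI[of "1 - \<delta>"]) auto
    then show "eventually (\<lambda>x. dist ((\<Sum>n. a n * x ^ n) - (\<Sum>n. a n)) 0 < e) (at_left 1)"
    proof eventually_elim
      case (elim x)
      have x: "0 < x" "x < 1" "(1 - x) < e / (2 * (C + 1))"
        using elim by (auto simp: \<delta>_def)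
      have geo: "(\<Sum>n. x ^ n) = 1 / (1 - x)" "summable (\<lambda>n. x ^ n)"
        using x by (simp_all add: suminf_geometric summable_geometric)
      have "\<bar>\<Sum>n. s n * x ^ n\<bar> \<le> (\<Sum>n. \<bar>s n\<bar> * x ^ n)"
        using summable_rabs[of "\<lambda>n. s n * x ^ n"] sm[OF x(1,2)] x by (simp add: abs_mult)
      also have "\<dots> = (\<Sum>n. \<bar>s (n + N)\<bar> * x ^ (n + N)) + (\<Sum>n<N. \<bar>s n\<bar> * x ^ n)"
        using sm[OF x(1,2)] by (rule suminf_split_initial_segment)
      also have "\<dots> \<le> (\<Sum>n. e / 2 * x ^ n) + C"
      proof (rule add_mono)
        show "(\<Sum>n. \<bar>s (n + N)\<bar> * x ^ (n + N)) \<le> (\<Sum>n. e / 2 * x ^ n)"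
        proof (rule suminf_le)
          fix n
          have "x ^ (n + N) \<le> x ^ n" using x by (intro power_decreasing) auto
          then show "\<bar>s (n + N)\<bar> * x ^ (n + N) \<le> e / 2 * x ^ n"
            using N[of "n + N"] e x by (intro mult_mono) auto
        qed (use summable_ignore_initial_segment[OF sm[OF x(1,2)], of N] geo in \<open>auto intro: summable_mult\<close>)
        show "(\<Sum>n<N. \<bar>s n\<bar> * x ^ n) \<le> C"
          unfolding C_def using x by (intro sum_mono) (simp add: mult_left_le power_le_one)
      qed
      also have "\<dots> = e / 2 / (1 - x) + C"
        unfolding suminf_mult[OF geo(2)] geo(1) by simp
      finally have "(1 - x) * \<bar>\<Sum>n. s n * x ^ n\<bar> \<le> (1 - x) * (e / 2 / (1 - x) + C)"
        using x by (intro mult_left_mono) auto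
      also have "\<dots> = e / 2 + (1 - x) * C"
        using x by (simp add: field_simps)
      also have "(1 - x) * C \<le> (1 - x) * (C + 1)"
        using x by (intro mult_left_mono) auto
      also have "\<dots> < e / 2"
        using x C by (simp add: field_simps)
      finally show ?case
        using x eq[OF x(1,2)] by (simp add: abs_mult)
    qed
  qed
  then show ?thesis by (rule LIM_zero_cancel)
qed

text \<open>With \<open>c = k + \<alpha>\<close> this produces the denominators of the zeta series;
  with \<open>c = \<alpha>\<close> it supplies the integrable majorant of the integral
  representation.\<close>

lemma Gamma_has_bochner_integral:
  assumes s: "s > (0::real)" and c: "c > 0"
  shows "has_bochner_integral lborel (\<lambda>t. indicator {0<..} t * (t powr (s - 1) * exp (- c * t)))
    (Gamma s / c powr s)"
proof -
  have base: "has_bochner_integral lborel (\<lambda>t. indicator {0<..} t * (t powr (s - 1) * exp (- t))) (Gamma s)"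
  proof (rule has_bochner_integral_nn_integral)
    have "(\<integral>\<^sup>+t. ennreal (indicator {0<..} t * (t powr (s - 1) * exp (- t))) \<partial>lborel) =
        (\<integral>\<^sup>+t. ennreal (indicator {0..} t * t powr (s - 1) / exp t) \<partial>lborel)"
      by (intro nn_integral_cong) (auto simp: indicator_def exp_minus field_simps)
    then show "(\<integral>\<^sup>+t. ennreal (indicator {0<..} t * (t powr (s - 1) * exp (- t))) \<partial>lborel) = ennreal (Gamma s)"
      using Gamma_conv_nn_integral_real[OF s] by simp
  qed (use s in \<open>auto intro: less_imp_le Gamma_real_pos\<close>)
  have "has_bochner_integral lborel
      (\<lambda>t. indicator {0<..} (0 + c * t) * ((0 + c * t) powr (s - 1) * exp (- (0 + c * t)))) (Gamma s /\<^sub>R \<bar>c\<bar>)"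
    using base c by (subst (asm) lborel_has_bochner_integral_real_affine_iff[of c _ _ 0]) auto
  \<comment> \<open>The new factor cancels the \<open>c powr (s - 1)\<close> that the substitution
    pulls out of the power.\<close>
  then have "has_bochner_integral lborel
      (\<lambda>t. (indicator {0<..} (0 + c * t) * ((0 + c * t) powr (s - 1) * exp (- (0 + c * t)))) * c powr (1 - s))
      (Gamma s /\<^sub>R \<bar>c\<bar> * c powr (1 - s))"
    by (rule has_bochner_integral_mult_left[rotated])
  moreover have "(indicator {0<..} (0 + c * t) * ((0 + c * t) powr (s - 1) * exp (- (0 + c * t)))) * c powr (1 - s)
      = indicator {0<..} t * (t powr (s - 1) * exp (- c * t))" for t
    using c by (auto simp: indicator_def powr_mult zero_less_mult_iff powr_diff)
  moreover have "Gamma s /\<^sub>R \<bar>c\<bar> * c powr (1 - s) = Gamma s / c powr s"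
    using c by (simp add: powr_diff field_simps)
  ultimately show ?thesis by (simp only:)
qed

text \<open>This is the binomial series with exponent \<open>- r\<close>, its rising factorials
  written as quotients of Gamma values.\<close>

lemma Gamma_binomial_series:
  fixes r z :: real
  assumes r: "r > 0" and z: "\<bar>z\<bar> < 1"
  shows "(\<lambda>k. Gamma (r + real k) / fact k * z ^ k) sums (Gamma r / (1 - z) powr r)"
proof -
  have "(\<lambda>k. ((- r) gchoose k) * (- z) ^ k) sums (1 + - z) powr (- r)"
    by (rule Generalised_Binomial_Theorem.gen_binomial_real) (use z in auto)
  then have "(\<lambda>k. Gamma r * (((- r) gchoose k) * (- z) ^ k)) sums (Gamma r * (1 + - z) powr (- r))"
    by (rule sums_mult)
  moreover have "Gamma r * (((- r) gchoose k) * (- z) ^ k) = Gamma (r + real k) / fact k * z ^ k" for k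
  proof -
    have "r \<notin> \<int>\<^sub>\<le>\<^sub>0" using r by (auto elim!: nonpos_Ints_cases)
    then have "pochhammer r k = Gamma (r + real k) / Gamma r"
      by (simp add: pochhammer_Gamma)
    moreover have "(- 1) ^ k * (- z) ^ k = z ^ k"
      by (simp flip: power_mult_distrib)
    ultimately show ?thesis
      using Gamma_real_pos[OF r] by (simp add: gbinomial_pochhammer field_simps)
  qed
  ultimately show ?thesis by (simp add: powr_minus field_simps)
qed

lemma hurwitz_lerch_summand_nonneg:
  fixes r s \<alpha> :: real
  assumes "r > 0"
  shows "Gamma (r + real k) / fact k / (real k + \<alpha>) powr s \<ge> 0"
  using assms Gamma_real_pos[of "r + real k"] by simp

text \<open>The negative binomial factor of the integrand is expanded and integrated term by term.
  The interchange requires the integrals of the absolute values to be summable, and these are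
  \<open>Gamma s\<close> times the terms of the series assumed to converge.\<close>

lemma hurwitz_lerch_series_eq_integral:
  fixes r s \<alpha> x :: real
  assumes r: "r > 0" and s: "s > 0" and \<alpha>: "\<alpha> > 0" and x: "0 < x" "x < 1"
    and sum: "summable (\<lambda>k. Gamma (r + real k) / fact k / (real k + \<alpha>) powr s * x ^ k)"
  shows "(\<Sum>k. Gamma (r + real k) / fact k / (real k + \<alpha>) powr s * (- x) ^ k) =
    Gamma r / Gamma s * (\<integral>t. indicator {0<..} t * (t powr (s - 1) * exp (- \<alpha> * t) / (1 + x * exp (- t)) powr r) \<partial>lborel)"
proof -
  define w where "w k t = indicator {0<..} t * (t powr (s - 1) * exp (- (real k + \<alpha>) * t))" for k t
  define F where "F k t = Gamma (r + real k) / fact k * (- x) ^ k * w k t" for k t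
  have w: "has_bochner_integral lborel (w k) (Gamma s / (real k + \<alpha>) powr s)" for k
    unfolding w_def using s \<alpha> by (intro Gamma_has_bochner_integral) auto
  have Fnorm: "norm (F k t) = Gamma (r + real k) / fact k * x ^ k * w k t" for k t
    using r x Gamma_real_pos[of "r + real k"] by (simp add: F_def w_def abs_mult power_abs)
  have F: "has_bochner_integral lborel (F k)
      (Gamma (r + real k) / fact k * (- x) ^ k * (Gamma s / (real k + \<alpha>) powr s))" for k
    unfolding F_def by (intro has_bochner_integral_mult_right w)
  have Fn: "has_bochner_integral lborel (\<lambda>t. norm (F k t))
      (Gamma (r + real k) / fact k * x ^ k * (Gamma s / (real k + \<alpha>) powr s))" for k
    unfolding Fnorm by (intro has_bochner_integral_mult_right w)
  \<comment> \<open>The same binomial series is used at \<open>- (x * exp (- t))\<close> for the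
    value and at \<open>x * exp (- t)\<close> for absolute convergence. For \<open>t \<le> 0\<close>
    the indicator makes every term vanish.\<close>
  have point: "(\<lambda>k. F k t) sums (Gamma r * (indicator {0<..} t * (t powr (s - 1) * exp (- \<alpha> * t) / (1 + x * exp (- t)) powr r)))"
    and abspoint: "summable (\<lambda>k. norm (F k t))" for t
  proof -
    have F': "F k t = Gamma (r + real k) / fact k * (- (x * exp (- t))) ^ k * (indicator {0<..} t * (t powr (s - 1) * exp (- \<alpha> * t)))"
      and Fnorm': "norm (F k t) = Gamma (r + real k) / fact k * (x * exp (- t)) ^ k * (indicator {0<..} t * (t powr (s - 1) * exp (- \<alpha> * t)))" for k
    proof -
      have e: "exp (- (real k + \<alpha>) * t) = exp (- t) ^ k * exp (- \<alpha> * t)"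
        by (simp add: exp_of_nat_mult[symmetric] exp_add[symmetric] algebra_simps)
      have m: "(- (x * exp (- t))) ^ k = (- x) ^ k * exp (- t) ^ k"
        by (simp flip: power_mult_distrib)
      show "F k t = Gamma (r + real k) / fact k * (- (x * exp (- t))) ^ k * (indicator {0<..} t * (t powr (s - 1) * exp (- \<alpha> * t)))"
        unfolding F_def w_def e m by (simp add: mult_ac)
      show "norm (F k t) = Gamma (r + real k) / fact k * (x * exp (- t)) ^ k * (indicator {0<..} t * (t powr (s - 1) * exp (- \<alpha> * t)))"
        unfolding Fnorm w_def e power_mult_distrib by (simp add: mult_ac)
    qed
    show "(\<lambda>k. F k t) sums (Gamma r * (indicator {0<..} t * (t powr (s - 1) * exp (- \<alpha> * t) / (1 + x * exp (- t)) powr r)))"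
    proof (cases "t > 0")
      case True
      then have "x * exp (- t) < 1"
        using x by (intro order.strict_trans1[OF mult_left_le]) auto
      then have "\<bar>- (x * exp (- t))\<bar> < 1" using x by simp
      from sums_mult2[OF Gamma_binomial_series[OF r this], of "t powr (s - 1) * exp (- \<alpha> * t)"]
      show ?thesis using True by (simp add: F')
    qed (simp add: F')
    show "summable (\<lambda>k. norm (F k t))"
    proof (cases "t > 0")
      case True
      then have "x * exp (- t) < 1"
        using x by (intro order.strict_trans1[OF mult_left_le]) auto
      then have "\<bar>x * exp (- t)\<bar> < 1" using x by simp
      from sums_mult2[OF Gamma_binomial_series[OF r this], of "t powr (s - 1) * exp (- \<alpha> * t)"]
      show ?thesis unfolding Fnorm' using True by (simp add: sums_iff)
    qed (unfold Fnorm', simp)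
  qed
  have "summable (\<lambda>k. \<integral>t. norm (F k t) \<partial>lborel)"
    unfolding has_bochner_integral_integral_eq[OF Fn] using summable_mult[OF sum, of "Gamma s"]
    by (simp add: mult_ac)
  then have "(\<lambda>k. \<integral>t. F k t \<partial>lborel) sums (\<integral>t. (\<Sum>k. F k t) \<partial>lborel)"
    using F abspoint by (intro sums_integral) (auto simp: has_bochner_integral_iff)
  also have "(\<lambda>t. \<Sum>k. F k t) = (\<lambda>t. Gamma r * (indicator {0<..} t * (t powr (s - 1) * exp (- \<alpha> * t) / (1 + x * exp (- t)) powr r)))"
    using point by (simp add: sums_iff)
  finally have "(\<lambda>k. Gamma (r + real k) / fact k * (- x) ^ k * (Gamma s / (real k + \<alpha>) powr s)) sums
     (Gamma r * (\<integral>t. (indicator {0<..} t * (t powr (s - 1) * exp (- \<alpha> * t) / (1 + x * exp (- t)) powr r)) \<partial>lborel))"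
    unfolding has_bochner_integral_integral_eq[OF F] by (simp only: integral_mult_right_zero)
  from sums_mult[OF this, of "1 / Gamma s"] show ?thesis
    using Gamma_real_pos[OF s] by (simp add: sums_iff mult_ac)
qed

text \<open>If the series converges at \<open>z = -1\<close>, even only conditionally, it agrees with the integral by
  letting \<open>z\<close> decrease to \<open>-1\<close> on both sides of the identity valid for \<open>\<bar>z\<bar> < 1\<close>.\<close>

lemma hurwitz_lerch_zeta_integral:
  fixes r s \<alpha> :: real
  assumes r: "r > 0" and s: "s > 0" and \<alpha>: "\<alpha> > 0"
  shows "hurwitz_lerch_zeta r (- 1) s \<alpha> =
    1 / Gamma s * (\<integral>t. indicator {0<..} t * (t powr (s - 1) * exp (- \<alpha> * t) / (1 + exp (- t)) powr r) \<partial>lborel)"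
proof (cases "summable (hurwitz_lerch_term r (- 1) s \<alpha>)")
  case False
  then show ?thesis
    by (simp add: hurwitz_lerch_zeta_def hurwitz_lerch_integral_def set_lebesgue_integral_def)
next
  case True
  define c where "c k = Gamma (r + real k) / fact k / (real k + \<alpha>) powr s" for k
  define I where "I x = (\<integral>t. indicator {0<..} t * (t powr (s - 1) * exp (- \<alpha> * t) / (1 + x * exp (- t)) powr r) \<partial>lborel)" for x
  have T: "hurwitz_lerch_term r (- 1) s \<alpha> = (\<lambda>k. c k * (- 1) ^ k)"
    by (simp add: fun_eq_iff hurwitz_lerch_term_def c_def)
  \<comment> \<open>The offset 2 keeps the sequence strictly between 0 and 1 already at
    \<open>n = 0\<close>.\<close>
  have "(\<lambda>n. 1 - 1 / real (n + 2)) \<longlonglongrightarrow> 1 - 0"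
    by (intro tendsto_intros LIMSEQ_ignore_initial_segment lim_1_over_n)
  then have xlim: "(\<lambda>n. 1 - 1 / real (n + 2)) \<longlonglongrightarrow> 1" by simp
  then have "filterlim (\<lambda>n. 1 - 1 / real (n + 2)) (at_left 1) sequentially"
    by (auto simp: filterlim_at)
  from filterlim_compose[OF Abel_limit[OF True[unfolded T]] this]
  have "(\<lambda>n. \<Sum>k. c k * (- 1) ^ k * (1 - 1 / real (n + 2)) ^ k) \<longlonglongrightarrow> (\<Sum>k. c k * (- 1) ^ k)" .
  moreover have "(\<Sum>k. c k * (- 1) ^ k * (1 - 1 / real (n + 2)) ^ k) = Gamma r / Gamma s * I (1 - 1 / real (n + 2))" for n
  proof -
    let ?x = "1 - 1 / real (n + 2)"
    have x: "0 < ?x" "?x < 1" by (auto simp: field_simps)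
    \<comment> \<open>Convergence at -1, even conditional, forces absolute convergence at every
      smaller radius.\<close>
    have "summable (\<lambda>k. norm (c k * (- ?x) ^ k))"
      using True[unfolded T] by (rule powser_insidea) (use x in auto)
    moreover have "norm (c k * (- ?x) ^ k) = c k * ?x ^ k" for k
    proof -
      have "c k \<ge> 0" unfolding c_def by (rule hurwitz_lerch_summand_nonneg[OF r])
      moreover have "\<bar>?x\<bar> = ?x" using x by linarith
      ultimately show ?thesis
        unfolding real_norm_def abs_mult power_abs abs_minus_cancel by simp
    qed
    ultimately have "summable (\<lambda>k. c k * ?x ^ k)" by (simp only:)
    from hurwitz_lerch_series_eq_integral[OF r s \<alpha> x this[unfolded c_def]]
    have "(\<Sum>k. c k * (- ?x) ^ k) = Gamma r / Gamma s * I ?x"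
      unfolding c_def I_def .
    moreover have "(- ?x) ^ k = (- 1) ^ k * ?x ^ k" for k by (rule power_minus)
    ultimately show ?thesis by (simp add: mult.assoc)
  qed
  ultimately have lim1: "(\<lambda>n. Gamma r / Gamma s * I (1 - 1 / real (n + 2))) \<longlonglongrightarrow> (\<Sum>k. c k * (- 1) ^ k)"
    by simp
  \<comment> \<open>The denominators are at least 1 for all these radii, so the Gamma integrand is a
    common majorant.\<close>
  have "(\<lambda>n. I (1 - 1 / real (n + 2))) \<longlonglongrightarrow> I 1"
    unfolding I_def
  proof (rule integral_dominated_convergence)
    show "integrable lborel (\<lambda>t. indicator {0<..} t * (t powr (s - 1) * exp (- \<alpha> * t)))"
      using Gamma_has_bochner_integral[OF s \<alpha>] by (simp add: has_bochner_integral_iff)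
    show "AE t in lborel. (\<lambda>n. indicator {0<..} t * (t powr (s - 1) * exp (- \<alpha> * t) / (1 + (1 - 1 / real (n + 2)) * exp (- t)) powr r)) \<longlonglongrightarrow>
        indicator {0<..} t * (t powr (s - 1) * exp (- \<alpha> * t) / (1 + 1 * exp (- t)) powr r)"
    proof (rule AE_I2)
      fix t :: real
      have "1 + exp (- t) > 0" by (simp add: add_pos_pos)
      then show "(\<lambda>n. indicator {0<..} t * (t powr (s - 1) * exp (- \<alpha> * t) / (1 + (1 - 1 / real (n + 2)) * exp (- t)) powr r)) \<longlonglongrightarrow>
        indicator {0<..} t * (t powr (s - 1) * exp (- \<alpha> * t) / (1 + 1 * exp (- t)) powr r)"
        by (intro tendsto_intros xlim) auto
    qed
    show "AE t in lborel. norm (indicator {0<..} t * (t powr (s - 1) * exp (- \<alpha> * t) / (1 + (1 - 1 / real (n + 2)) * exp (- t)) powr r))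
        \<le> indicator {0<..} t * (t powr (s - 1) * exp (- \<alpha> * t))" for n
    proof (rule AE_I2)
      fix t :: real
      have "1 - 1 / real (n + 2) \<ge> 0" by (simp add: field_simps)
      then have "(1 + (1 - 1 / real (n + 2)) * exp (- t)) powr r \<ge> 1"
        using r by (intro ge_one_powr_ge_zero) auto
      then have "A / (1 + (1 - 1 / real (n + 2)) * exp (- t)) powr r \<le> A" if "A \<ge> 0" for A
        using that divide_left_mono[of 1 _ A] by simp
      from this[of "t powr (s - 1) * exp (- \<alpha> * t)"]
      show "norm (indicator {0<..} t * (t powr (s - 1) * exp (- \<alpha> * t) / (1 + (1 - 1 / real (n + 2)) * exp (- t)) powr r))
        \<le> indicator {0<..} t * (t powr (s - 1) * exp (- \<alpha> * t))"
        by (simp add: indicator_def)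
    qed
  qed measurable
  then have "(\<lambda>n. Gamma r / Gamma s * I (1 - 1 / real (n + 2))) \<longlonglongrightarrow> Gamma r / Gamma s * I 1"
    by (intro tendsto_intros)
  with lim1 have "(\<Sum>k. c k * (- 1) ^ k) = Gamma r / Gamma s * I 1"
    by (rule LIMSEQ_unique)
  then show ?thesis
    using True Gamma_real_pos[OF r] by (simp add: hurwitz_lerch_zeta_def T I_def)
qed

section \<open>Radial integrals\<close>

lemma nn_integral_gaussian_moment:
  "(\<integral>\<^sup>+x. ennreal (exp (- x\<^sup>2) * x ^ (2 * k)) \<partial>lborel) =
    ennreal (sqrt pi * (fact (2 * k) / (4 ^ k * fact k)))"
proof -
  have "has_bochner_integral lborel (\<lambda>x::real. exp (- x\<^sup>2) * x ^ (2 * k))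
      (2 *\<^sub>R (sqrt pi / 2 * (fact (2 * k) / (2 ^ (2 * k) * fact k))))"
    by (rule has_bochner_integral_even_function[OF gaussian_moment_even_pos]) simp
  then show ?thesis
    by (simp add: nn_integral_eq_integral has_bochner_integral_iff power_mult)
qed

text \<open>This is the distribution function of the power density on the positive half-line,
  recorded for every real \<open>s\<close> because the measures compared later live on the whole
  line.\<close>

lemma nn_integral_powr_atMost:
  fixes p s :: real
  assumes "p > 0"
  shows "(\<integral>\<^sup>+u. ennreal (indicator {0<..} u * u powr (p - 1)) * indicator {..s} u \<partial>lborel)
    = ennreal (if s > 0 then s powr p / p else 0)"
proof (cases "s > 0")
  case True
  have "(\<integral>\<^sup>+u. ennreal (indicator {0<..} u * u powr (p - 1)) * indicator {..s} u \<partial>lborel)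
      = (\<integral>\<^sup>+u. ennreal (u powr (p - 1)) * indicator {0..s} u \<partial>lborel)"
    by (intro nn_integral_cong) (auto simp: indicator_def)
  also have "\<dots> = ennreal (s powr (p - 1 + 1) / (p - 1 + 1))"
    by (rule nn_integral_has_integral_lebesgue'[OF _ has_integral_powr_from_0])
      (use assms True in auto)
  finally show ?thesis using True by simp
next
  case False
  then have "(\<integral>\<^sup>+u. ennreal (indicator {0<..} u * u powr (p - 1)) * indicator {..s} u \<partial>lborel)
      = (\<integral>\<^sup>+(u::real). 0 \<partial>lborel)"
    by (intro nn_integral_cong) (auto simp: indicator_def)
  then show ?thesis using False by simp
qed

text \<open>The weight is homogeneous of degree \<open>2 \<Sum>k\<close>, so its integral over the ball of squared radius \<open>s\<close>
  is a multiple of \<open>s\<^sup>p\<close>; a Gaussian generator then determines the constant.\<close>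

lemma nn_integral_monomial_radial:
  fixes k :: "'a::euclidean_space \<Rightarrow> nat" and g :: "real \<Rightarrow> ennreal"
  assumes g [measurable]: "g \<in> borel_measurable borel"
  defines "p \<equiv> real DIM('a) / 2 + real (\<Sum>b\<in>Basis. k b)"
  shows "(\<integral>\<^sup>+(x::'a). ennreal (\<Prod>b\<in>Basis. (x \<bullet> b) ^ (2 * k b)) * g (x \<bullet> x) \<partial>lborel) =
    ennreal ((\<Prod>b\<in>Basis. sqrt pi * (fact (2 * k b) / (4 ^ k b * fact (k b)))) / Gamma p) *
    (\<integral>\<^sup>+u. ennreal (indicator {0<..} u * u powr (p - 1)) * g u \<partial>lborel)"
proof -
  define W where "W = (\<Sum>b\<in>Basis. k b)"
  define w where "w x = (\<Prod>b\<in>Basis. (x \<bullet> b) ^ (2 * k b))" for x :: 'a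
  define G where "G = (\<Prod>b\<in>(Basis::'a set). sqrt pi * (fact (2 * k b) / (4 ^ k b * fact (k b))))"
  have p: "p > 0" unfolding p_def by (intro add_pos_nonneg of_nat_0_le_iff) simp
  have G: "G > 0" by (auto simp: G_def intro!: prod_pos)
  have w0: "w x \<ge> 0" for x by (simp add: w_def prod_nonneg)
  have [measurable]: "w \<in> borel_measurable borel" unfolding w_def by measurable
  \<comment> \<open>\<open>F\<close> is the distribution function of the image of
    \<open>w x dx\<close> under the squared norm.\<close>
  define F where "F s = (\<integral>\<^sup>+x. ennreal (w x) * indicator {..s} (x \<bullet> x) \<partial>lborel)" for s
  have gauss: "(\<integral>\<^sup>+x. ennreal (w x) * ennreal (exp (- (x \<bullet> x))) \<partial>lborel) = ennreal G"
  proof -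
    have "(\<integral>\<^sup>+x. ennreal (w x) * ennreal (exp (- (x \<bullet> x))) \<partial>lborel) =
        (\<integral>\<^sup>+x. (\<Prod>b\<in>Basis. ennreal (exp (- (x \<bullet> b)\<^sup>2) * (x \<bullet> b) ^ (2 * k b))) \<partial>(lborel::'a measure))"
    proof (rule nn_integral_cong)
      fix x :: 'a
      have "x \<bullet> x = (\<Sum>b\<in>Basis. (x \<bullet> b)\<^sup>2)"
        by (simp add: euclidean_inner[of x x] power2_eq_square)
      then have "exp (- (x \<bullet> x)) = (\<Prod>b\<in>Basis. exp (- (x \<bullet> b)\<^sup>2))"
        by (simp add: exp_sum flip: sum_negf)
      then have "w x * exp (- (x \<bullet> x)) = (\<Prod>b\<in>Basis. exp (- (x \<bullet> b)\<^sup>2) * (x \<bullet> b) ^ (2 * k b))"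
        by (simp add: w_def prod.distrib)
      then have "ennreal (w x) * ennreal (exp (- (x \<bullet> x))) =
          ennreal (\<Prod>b\<in>Basis. exp (- (x \<bullet> b)\<^sup>2) * (x \<bullet> b) ^ (2 * k b))"
        by (simp flip: ennreal_mult'')
      also have "\<dots> = (\<Prod>b\<in>Basis. ennreal (exp (- (x \<bullet> b)\<^sup>2) * (x \<bullet> b) ^ (2 * k b)))"
        by (rule prod_ennreal[symmetric]) simp
      finally show "ennreal (w x) * ennreal (exp (- (x \<bullet> x))) =
          (\<Prod>b\<in>Basis. ennreal (exp (- (x \<bullet> b)\<^sup>2) * (x \<bullet> b) ^ (2 * k b)))" .
    qed
    also have "\<dots> = (\<Prod>b\<in>(Basis::'a set). \<integral>\<^sup>+x. ennreal (exp (- x\<^sup>2) * x ^ (2 * k b)) \<partial>lborel)"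
      by (rule nn_integral_lborel_prod) auto
    also have "\<dots> = ennreal G"
      unfolding nn_integral_gaussian_moment G_def by (intro prod_ennreal) auto
    finally show ?thesis .
  qed
  \<comment> \<open>Dilation by \<open>sqrt s\<close> contributes half the dimension to the exponent
    through the volume, and \<open>W\<close> through the weight; together these make
    \<open>p\<close>.\<close>
  have scaling: "F s = ennreal (s powr p) * F 1" if s: "s > 0" for s
  proof -
    let ?f = "\<lambda>x. ennreal (w x) * indicator {..s} (x \<bullet> x)"
    have "F s = (\<integral>\<^sup>+x. ?f x \<partial>(density (distr lborel borel (\<lambda>x::'a. 0 + sqrt s *\<^sub>R x)) (\<lambda>_. \<bar>sqrt s\<bar> ^ DIM('a))))"
      unfolding F_def by (subst lborel_affine[of "sqrt s" 0]) (use s in auto)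
    also have "\<dots> = (\<integral>\<^sup>+x. ennreal (sqrt s ^ DIM('a)) * ?f (sqrt s *\<^sub>R x) \<partial>lborel)"
      using s by (subst nn_integral_density) (auto simp: nn_integral_distr)
    also have "\<dots> = (\<integral>\<^sup>+x. ennreal (s powr p) * (ennreal (w x) * indicator {..1} (x \<bullet> x)) \<partial>lborel)"
    proof (rule nn_integral_cong)
      fix x :: 'a
      have "w (sqrt s *\<^sub>R x) = s ^ W * w x"
        using s by (simp add: w_def W_def power_mult_distrib prod.distrib power_sum power_mult)
      moreover have "sqrt s ^ DIM('a) = s powr (real DIM('a) / 2)"
        using s by (simp add: powr_half_sqrt[symmetric] powr_powr flip: powr_realpow)
      then have "sqrt s ^ DIM('a) * s ^ W = s powr p"
        using s powr_realpow[OF s, of W] by (simp only: p_def powr_add flip: W_def)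
      moreover have "sqrt s * (sqrt s * (x \<bullet> x)) \<le> s \<longleftrightarrow> x \<bullet> x \<le> 1"
        using s by (simp flip: mult.assoc)
      ultimately show "ennreal (sqrt s ^ DIM('a)) * ?f (sqrt s *\<^sub>R x) =
          ennreal (s powr p) * (ennreal (w x) * indicator {..1} (x \<bullet> x))"
        using s w0[of x] by (simp add: indicator_def mult.assoc[symmetric] flip: ennreal_mult')
    qed
    also have "\<dots> = ennreal (s powr p) * F 1"
      unfolding F_def by (rule nn_integral_cmult) measurable
    finally show ?thesis .
  qed
  \<comment> \<open>At \<open>s = 0\<close> the region is reduced to the origin, a null set; below 0
    it is empty.\<close>
  have null: "F s = 0" if "s \<le> 0" for s
  proof -
    have "F s = (\<integral>\<^sup>+(x::'a). 0 \<partial>lborel)"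
      unfolding F_def
    proof (rule nn_integral_cong_AE)
      show "AE x in lborel. ennreal (w x) * indicator {..s} (x \<bullet> x) = 0"
        using AE_lborel_singleton[of "0::'a"]
      proof eventually_elim
        case (elim x)
        then have "x \<bullet> x > s" using that by (meson inner_gt_zero_iff le_less_trans)
        then show ?case by simp
      qed
    qed
    then show ?thesis by simp
  qed
  \<comment> \<open>Finiteness is borrowed from the Gaussian integral: on the unit ball
    \<open>exp (- (x \<bullet> x))\<close> is at least 1/e.\<close>
  have "F 1 \<le> (\<integral>\<^sup>+x. ennreal (exp 1) * (ennreal (w x) * ennreal (exp (- (x \<bullet> x)))) \<partial>lborel)"
    unfolding F_def
  proof (rule nn_integral_mono)
    fix x :: 'a
    have "w x \<le> exp 1 * (w x * exp (- (x \<bullet> x)))" if "x \<bullet> x \<le> 1"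
    proof -
      have "1 \<le> exp 1 * exp (- (x \<bullet> x))" using that by (simp flip: exp_add)
      from mult_left_mono[OF this w0[of x]] show ?thesis by (simp add: mult_ac)
    qed
    then show "ennreal (w x) * indicator {..1} (x \<bullet> x) \<le> ennreal (exp 1) * (ennreal (w x) * ennreal (exp (- (x \<bullet> x))))"
      using w0[of x] by (simp add: indicator_def flip: ennreal_mult')
  qed
  also have "\<dots> = ennreal (exp 1) * ennreal G"
    by (subst nn_integral_cmult) (auto simp: gauss)
  also have "\<dots> < \<infinity>" by (simp add: ennreal_mult_less_top)
  finally obtain c where c: "c \<ge> 0" "F 1 = ennreal c"
    by (cases "F 1") auto
  \<comment> \<open>The density of \<open>?R\<close> is the derivative of
    \<open>c * s powr p\<close>. Hence both measures agree, with finite values, on the half-lines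
    \<open>{..s}\<close>, an intersection-stable generator of the Borel sets.\<close>
  let ?N = "distr (density lborel (\<lambda>x. ennreal (w x))) borel (\<lambda>x::'a. x \<bullet> x)"
  let ?R = "density lborel (\<lambda>u. ennreal (c * p) * ennreal (indicator {0<..} u * u powr (p - 1)))"
  have N: "emeasure ?N {..s} = F s" for s
  proof -
    have "emeasure ?N {..s} = (\<integral>\<^sup>+u. indicator {..s} u \<partial>?N)"
      by simp
    also have "\<dots> = F s"
      unfolding F_def by (subst nn_integral_distr, simp, simp) (subst nn_integral_density, auto)
    finally show ?thesis .
  qed
  have F: "F s = ennreal (if s > 0 then c * s powr p else 0)" for s
    using scaling[of s] null[of s] c by (simp add: mult.commute flip: ennreal_mult')
  have "?N = ?R"
  proof (rule measure_eqI_generator_eq[where \<Omega> = UNIV and E = "range (\<lambda>s::real. {..s})" and A = "\<lambda>i. {..real i}"])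
    show "Int_stable (range (\<lambda>s::real. {..s}))"
      by (auto simp: Int_stable_def)
    show "emeasure ?N X = emeasure ?R X" if "X \<in> range (\<lambda>s::real. {..s})" for X
    proof -
      from that obtain s where X: "X = {..s}" by auto
      have "emeasure ?R {..s} = (\<integral>\<^sup>+u. ennreal (c * p) * (ennreal (indicator {0<..} u * u powr (p - 1)) * indicator {..s} u) \<partial>lborel)"
        by (subst emeasure_density) (auto simp: mult.assoc)
      also have "\<dots> = ennreal (c * p) * ennreal (if s > 0 then s powr p / p else 0)"
        by (subst nn_integral_cmult) (auto simp: nn_integral_powr_atMost[OF p])
      also have "\<dots> = F s"
        using c p by (simp add: F flip: ennreal_mult')
      finally show ?thesis by (simp add: X N)
    qed
    show "emeasure ?N {..real i} \<noteq> \<infinity>" for i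
      by (simp add: N F)
    show "(\<Union>i. {..real i}) = UNIV"
      using real_arch_simple by auto
  qed (auto simp: borel_eq_atMost)
  have master: "(\<integral>\<^sup>+x. ennreal (w x) * h (x \<bullet> x) \<partial>lborel) =
      ennreal (c * p) * (\<integral>\<^sup>+u. ennreal (indicator {0<..} u * u powr (p - 1)) * h u \<partial>lborel)"
    if [measurable]: "h \<in> borel_measurable borel" for h :: "real \<Rightarrow> ennreal"
  proof -
    have "(\<integral>\<^sup>+x. ennreal (w x) * h (x \<bullet> x) \<partial>lborel) = (\<integral>\<^sup>+u. h u \<partial>?N)"
      by (simp add: nn_integral_distr nn_integral_density)
    also have "\<dots> = (\<integral>\<^sup>+u. ennreal (c * p) * (ennreal (indicator {0<..} u * u powr (p - 1)) * h u) \<partial>lborel)"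
      unfolding \<open>?N = ?R\<close> by (subst nn_integral_density) (auto simp: mult.assoc)
    also have "\<dots> = ennreal (c * p) * (\<integral>\<^sup>+u. ennreal (indicator {0<..} u * u powr (p - 1)) * h u \<partial>lborel)"
      by (rule nn_integral_cmult) measurable
    finally show ?thesis .
  qed
  have "(\<integral>\<^sup>+u. ennreal (indicator {0<..} u * u powr (p - 1)) * ennreal (exp (- u)) \<partial>lborel) =
      (\<integral>\<^sup>+u. ennreal (indicator {0..} u * u powr (p - 1) / exp u) \<partial>lborel)"
    by (intro nn_integral_cong) (auto simp: indicator_def exp_minus field_simps simp flip: ennreal_mult')
  also have "\<dots> = ennreal (Gamma p)"
    using Gamma_conv_nn_integral_real[OF p] by simp
  finally have "ennreal G = ennreal (c * p) * ennreal (Gamma p)"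
    using master[of "\<lambda>u. ennreal (exp (- u))"] gauss by simp
  then have "G = c * p * Gamma p"
    using c p G Gamma_real_pos[OF p] by (simp flip: ennreal_mult')
  then have "c * p = G / Gamma p"
    using Gamma_real_pos[OF p] by (simp add: field_simps)
  then show ?thesis
    using master[OF g] by (simp add: w_def G_def)
qed

section \<open>Moments of elliptical logistic vectors\<close>

lemma nn_integral_logistic_generator:
  fixes a b r p :: real
  assumes a: "a > 0" and b: "b > 0" and r: "r > 0" and p: "p > 0"
  shows "(\<integral>\<^sup>+u. ennreal (indicator {0<..} u * u powr (p - 1)) * ennreal (logistic_generator a b r u) \<partial>lborel)
    = ennreal (Gamma p * hurwitz_lerch_zeta r (- 1) p (b / a) / a powr p)"
proof -
  define h where "h t = indicator {0<..} t * (t powr (p - 1) * exp (- (b / a) * t) / (1 + exp (- t)) powr r)" for t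
  have h0: "h t \<ge> 0" for t by (simp add: h_def indicator_def)
  have ba: "b / a > 0" using a b by simp
  \<comment> \<open>Integrability is what lets the Bochner integral behind the zeta function be read
    as an extended one. The denominator is at least 1, so a Gamma integrand dominates.\<close>
  have "integrable lborel h"
  proof (rule Bochner_Integration.integrable_bound)
    show "integrable lborel (\<lambda>t. indicator {0<..} t * (t powr (p - 1) * exp (- (b / a) * t)))"
      using Gamma_has_bochner_integral[OF p ba] by (simp only: has_bochner_integral_iff)
    show "AE t in lborel. norm (h t) \<le> norm (indicator {0<..} t * (t powr (p - 1) * exp (- (b / a) * t)))"
    proof (rule AE_I2)
      fix t :: real
      have "(1 + exp (- t)) powr r \<ge> 1"
        using r by (intro ge_one_powr_ge_zero) auto
      then have "A / (1 + exp (- t)) powr r \<le> A" if "A \<ge> 0" for A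
        using that divide_left_mono[of 1 _ A] by simp
      from this[of "t powr (p - 1) * exp (- (b / a) * t)"]
      show "norm (h t) \<le> norm (indicator {0<..} t * (t powr (p - 1) * exp (- (b / a) * t)))"
        by (simp add: h_def indicator_def)
    qed
  qed (unfold h_def, measurable)
  then have h: "(\<integral>\<^sup>+t. ennreal (h t) \<partial>lborel) = ennreal (\<integral>t. h t \<partial>lborel)"
    by (intro nn_integral_eq_integral) (simp_all add: h0)
  have "(\<integral>\<^sup>+u. ennreal (indicator {0<..} u * u powr (p - 1)) * ennreal (logistic_generator a b r u) \<partial>lborel)
      = ennreal \<bar>1 / a\<bar> * (\<integral>\<^sup>+t. ennreal (indicator {0<..} (0 + 1 / a * t) * (0 + 1 / a * t) powr (p - 1)) *
          ennreal (logistic_generator a b r (0 + 1 / a * t)) \<partial>lborel)"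
    by (rule nn_integral_real_affine) (use a in \<open>auto simp: logistic_generator_def\<close>)
  also have "\<dots> = (\<integral>\<^sup>+t. ennreal (1 / a powr p) * ennreal (h t) \<partial>lborel)"
  proof (subst nn_integral_cmult[symmetric], simp add: logistic_generator_def, rule nn_integral_cong)
    fix t :: real
    have "1 / a * (1 / a * t) powr (p - 1) = 1 / a powr p * t powr (p - 1)" if "t > 0"
      using a that by (simp add: powr_divide powr_diff)
    moreover have "logistic_generator a b r (1 / a * t) = exp (- (b / a) * t) / (1 + exp (- t)) powr r"
      using a by (simp add: logistic_generator_def)
    ultimately have "1 / a * (indicator {0<..} (1 / a * t) * (1 / a * t) powr (p - 1) * logistic_generator a b r (1 / a * t))
        = 1 / a powr p * h t"
      using a by (cases "t > 0") (simp_all add: h_def indicator_def zero_less_mult_iff zero_less_divide_iff flip: mult.assoc)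
    moreover have "logistic_generator a b r (1 / a * t) \<ge> 0"
      by (simp add: logistic_generator_def)
    ultimately show "ennreal \<bar>1 / a\<bar> * (ennreal (indicator {0<..} (0 + 1 / a * t) * (0 + 1 / a * t) powr (p - 1)) *
          ennreal (logistic_generator a b r (0 + 1 / a * t))) = ennreal (1 / a powr p) * ennreal (h t)"
      using a h0[of t] by (simp flip: ennreal_mult'')
  qed
  also have "\<dots> = ennreal (1 / a powr p) * ennreal (\<integral>t. h t \<partial>lborel)"
    using \<open>integrable lborel h\<close> by (subst nn_integral_cmult) (simp_all add: h)
  also have "\<dots> = ennreal (1 / a powr p * (\<integral>t. h t \<partial>lborel))"
    by (simp add: h0 flip: ennreal_mult'')
  also have "1 / a powr p * (\<integral>t. h t \<partial>lborel) = Gamma p * hurwitz_lerch_zeta r (- 1) p (b / a) / a powr p"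
    using hurwitz_lerch_zeta_integral[OF r p ba] Gamma_real_pos[OF p] by (simp add: h_def)
  finally show ?thesis .
qed

text \<open>Nonnegativity allows products to be merged under \<open>ennreal\<close>. That the zeta
  value in the denominators is nonzero follows later from the total mass.\<close>

lemma hurwitz_lerch_zeta_nonneg:
  fixes r s \<alpha> :: real
  assumes "r > 0" "s > 0" "\<alpha> > 0"
  shows "hurwitz_lerch_zeta r (- 1) s \<alpha> \<ge> 0"
  unfolding hurwitz_lerch_zeta_integral[OF assms]
  by (intro mult_nonneg_nonneg integral_nonneg_AE AE_I2)
    (use Gamma_real_pos[OF \<open>s > 0\<close>] in \<open>auto simp: indicator_def\<close>)

section \<open>Densities of transformed vectors and standardization\<close>

lemma distributed_lborel_transform:
  fixes T :: "real^'n \<Rightarrow> real^'n"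
  assumes X: "distributed M lborel X f" and [measurable]: "T \<in> borel_measurable borel"
    and h [measurable]: "h \<in> borel_measurable borel"
    and eq: "\<And>A. A \<in> sets borel \<Longrightarrow>
      (\<integral>\<^sup>+x. f x * indicator A (T x) \<partial>lborel) = (\<integral>\<^sup>+y. h y * indicator A y \<partial>lborel)"
  shows "distributed M lborel (\<lambda>\<omega>. T (X \<omega>)) h"
proof -
  have [measurable]: "X \<in> M \<rightarrow>\<^sub>M borel"
    using distributed_measurable[OF X] by simp
  have "distr M lborel (\<lambda>\<omega>. T (X \<omega>)) = density lborel h"
  proof (rule measure_eqI)
    fix A assume "A \<in> sets (distr M lborel (\<lambda>\<omega>. T (X \<omega>)))"
    then have A [measurable]: "A \<in> sets borel" by simp
    have "emeasure (distr M lborel (\<lambda>\<omega>. T (X \<omega>))) A = (\<integral>\<^sup>+\<omega>. indicator A (T (X \<omega>)) \<partial>M)"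
      by (simp add: nn_integral_distr flip: nn_integral_indicator)
    also have "\<dots> = (\<integral>\<^sup>+x. f x * indicator A (T x) \<partial>lborel)"
      by (rule distributed_nn_integral[OF X, symmetric]) measurable
    also have "\<dots> = emeasure (density lborel h) A"
      by (simp add: eq emeasure_density)
    finally show "emeasure (distr M lborel (\<lambda>\<omega>. T (X \<omega>))) A = emeasure (density lborel h) A" .
  qed simp
  then show ?thesis
    by (simp add: distributed_def)
qed

lemma matrix_inverse:
  fixes A :: "'a::semiring_1^'n^'m"
  assumes "invertible A"
  shows "A ** matrix_inv A = mat 1" "matrix_inv A ** A = mat 1"
  using someI_ex[OF assms[unfolded invertible_def]] by (simp_all add: matrix_inv_def)

text \<open>From \<Sigma> = S S and R the inverse of S one gets \<Sigma>^(-1) S = R. The quadratic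
  form at \<open>S *v y\<close> is therefore (S y) \<bullet> (R y) = y \<bullet> (S R y) = y
  \<bullet> y, since S is self-adjoint. The determinant factor and the Jacobian \<open>c\<close>
  both disappear into \<open>K\<close>.\<close>

lemma GML_standardized:
  fixes X :: "'w \<Rightarrow> real^'n"
  assumes \<Sigma>: "pos_def_matrix \<Sigma>" and X: "GML M X \<mu> \<Sigma> g"
    and g [measurable]: "g \<in> borel_measurable borel" and g0: "\<And>u. g u \<ge> 0"
  obtains K where "K \<ge> 0"
    "distributed M lborel (\<lambda>\<omega>. matrix_inv (matrix_sqrt \<Sigma>) *v (X \<omega> - \<mu>)) (\<lambda>y. ennreal (K * g (y \<bullet> y)))"
proof -
  define S where "S = matrix_sqrt \<Sigma>"
  define R where "R = matrix_inv S"
  have S: "pos_def_matrix S" "S ** S = \<Sigma>"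
    using matrix_sqrt[OF \<Sigma>] by (simp_all add: S_def)
  have SR: "S ** R = mat 1" "R ** S = mat 1"
    using matrix_inverse[OF pos_def_invertible[OF S(1)]] by (simp_all add: R_def)
  have SRx: "S *v (R *v x) = x" "R *v (S *v x) = x" for x
    using SR by (simp_all add: matrix_vector_mul_assoc)
  have "matrix_inv \<Sigma> ** \<Sigma> = mat 1"
    using matrix_inverse[OF pos_def_invertible[OF \<Sigma>]] by simp
  then have "matrix_inv \<Sigma> *v (\<Sigma> *v (R *v x)) = R *v x" for x
    by (metis matrix_vector_mul_assoc matrix_vector_mul_lid)
  then have invS: "matrix_inv \<Sigma> *v (S *v x) = R *v x" for x
    by (simp add: SRx flip: S(2) matrix_vector_mul_assoc)
  have quad: "(S *v y) \<bullet> (matrix_inv \<Sigma> *v (S *v y)) = y \<bullet> y" for y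
    by (simp add: invS pos_def_selfadjoint[OF S(1)] SRx)
  obtain d where d: "d > 0" and dist: "distributed M lborel X
      (\<lambda>x. ennreal (d * det \<Sigma> powr (- 1 / 2) * g ((x - \<mu>) \<bullet> (matrix_inv \<Sigma> *v (x - \<mu>)))))"
    using X by (auto simp: GML_def)
  define K0 where "K0 = d * det \<Sigma> powr (- 1 / 2)"
  have K0: "K0 \<ge> 0" using d by (simp add: K0_def)
  have "bij ((*v) S)"
    using SRx by (intro o_bij[of "(*v) R"]) (auto simp: fun_eq_iff)
  then obtain c where c: "c > 0" and lin: "\<And>f. f \<in> borel_measurable borel \<Longrightarrow>
      (\<integral>\<^sup>+x. f (S *v x) \<partial>lborel) = ennreal c * (\<integral>\<^sup>+x. f x \<partial>lborel)"
    using nn_integral_lborel_linear[OF matrix_vector_mul_linear] by blast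
  have [measurable]: "(\<lambda>x. A *v x) \<in> borel_measurable borel" for A :: "real^'n^'n"
    by (intro borel_measurable_continuous_onI matrix_vector_mult_linear_continuous_on)
  let ?f = "\<lambda>x. ennreal (K0 * g ((x - \<mu>) \<bullet> (matrix_inv \<Sigma> *v (x - \<mu>))))"
  let ?h = "\<lambda>y. ennreal (K0 / c * g (y \<bullet> y))"
  have "distributed M lborel (\<lambda>\<omega>. R *v (X \<omega> - \<mu>)) ?h"
  proof (rule distributed_lborel_transform[OF dist[folded K0_def]])
    fix A :: "(real^'n) set" assume [measurable]: "A \<in> sets borel"
    let ?F = "\<lambda>x. ennreal (K0 * g (x \<bullet> (matrix_inv \<Sigma> *v x))) * indicator A (R *v x)"
    have "(\<integral>\<^sup>+x. ?f x * indicator A (R *v (x - \<mu>)) \<partial>lborel) = (\<integral>\<^sup>+x. ?F x \<partial>lborel)"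
      using nn_integral_lborel_shift[of ?F "- \<mu>"] by simp
    \<comment> \<open>Inserting \<open>c\<close> allows the linear substitution to be read from
      right to left.\<close>
    also have "\<dots> = ennreal (1 / c) * (ennreal c * (\<integral>\<^sup>+x. ?F x \<partial>lborel))"
      using c by (simp flip: mult.assoc ennreal_mult')
    also have "\<dots> = ennreal (1 / c) * (\<integral>\<^sup>+y. ?F (S *v y) \<partial>lborel)"
      by (subst lin) auto
    also have "\<dots> = (\<integral>\<^sup>+y. ennreal (1 / c) * ?F (S *v y) \<partial>lborel)"
      by (rule nn_integral_cmult[symmetric]) measurable
    also have "\<dots> = (\<integral>\<^sup>+y. ?h y * indicator A y \<partial>lborel)"
      using c K0 g0 by (intro nn_integral_cong) (simp add: quad SRx flip: mult.assoc ennreal_mult')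
    finally show "(\<integral>\<^sup>+x. ?f x * indicator A (R *v (x - \<mu>)) \<partial>lborel) = (\<integral>\<^sup>+y. ?h y * indicator A y \<partial>lborel)" .
  qed measurable
  with K0 c that[of "K0 / c"] show ?thesis
    by (simp add: R_def S_def)
qed

section \<open>Moments of spherically symmetric vectors\<close>

lemma prod_Basis_vec: "(\<Prod>b\<in>(Basis :: (real^'n) set). f b) = (\<Prod>i\<in>UNIV. f (axis i 1))"
proof -
  have *: "(Basis :: (real^'n) set) = range (\<lambda>i. axis i 1)" by (auto simp: Basis_vec_def)
  have "inj (\<lambda>i::'n. axis i (1::real))" by (auto simp: inj_on_def axis_eq_axis)
  then show ?thesis
    unfolding *  by (simp add: prod.reindex)
qed

lemma sum_Basis_vec: "(\<Sum>b\<in>(Basis :: (real^'n) set). f b) = (\<Sum>i\<in>UNIV. f (axis i 1))"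
proof -
  have *: "(Basis :: (real^'n) set) = range (\<lambda>i. axis i 1)" by (auto simp: Basis_vec_def)
  have "inj (\<lambda>i::'n. axis i (1::real))" by (auto simp: inj_on_def axis_eq_axis)
  then show ?thesis
    unfolding *  by (simp add: sum.reindex)
qed

lemma spherical_nn_even_moment:
  fixes Y :: "'w \<Rightarrow> real^'n" and k :: "'n \<Rightarrow> nat"
  assumes Y: "distributed M lborel Y (\<lambda>y. ennreal (K * g (y \<bullet> y)))"
    and K: "K \<ge> 0" and g [measurable]: "g \<in> borel_measurable borel" and g0: "\<And>u. g u \<ge> 0"
  defines "p \<equiv> real CARD('n) / 2 + real (\<Sum>i\<in>UNIV. k i)"
  shows "(\<integral>\<^sup>+\<omega>. ennreal (\<Prod>i\<in>UNIV. (Y \<omega> $ i) ^ (2 * k i)) \<partial>M) =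
    ennreal (K * sqrt pi ^ CARD('n) * (\<Prod>i\<in>UNIV. fact (2 * k i) / (4 ^ k i * fact (k i))) / Gamma p) *
    (\<integral>\<^sup>+u. ennreal (indicator {0<..} u * u powr (p - 1)) * ennreal (g u) \<partial>lborel)"
proof -
  \<comment> \<open>The exponents are moved from coordinate indices to basis vectors;
    \<open>axis i 1\<close> determines \<open>i\<close>, so the description is well defined.\<close>
  define k' where "k' b = k (THE i. b = axis i (1::real))" for b :: "real^'n"
  have k': "k' (axis i 1) = k i" for i
    by (simp add: k'_def axis_eq_axis)
  let ?w = "\<lambda>y::real^'n. \<Prod>i\<in>UNIV. (y $ i) ^ (2 * k i)"
  have p: "p > 0" unfolding p_def by (intro add_pos_nonneg of_nat_0_le_iff) simp_all
  have w0: "?w y \<ge> 0" for y by (simp add: prod_nonneg)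
  have "(\<integral>\<^sup>+\<omega>. ennreal (?w (Y \<omega>)) \<partial>M) = (\<integral>\<^sup>+y. ennreal (K * g (y \<bullet> y)) * ennreal (?w y) \<partial>lborel)"
    by (rule distributed_nn_integral[OF Y, symmetric]) measurable
  also have "\<dots> = (\<integral>\<^sup>+y. ennreal K * (ennreal (?w y) * ennreal (g (y \<bullet> y))) \<partial>lborel)"
    using K g0 by (intro nn_integral_cong) (simp add: ennreal_mult' mult_ac)
  also have "\<dots> = ennreal K * (\<integral>\<^sup>+y. ennreal (?w y) * ennreal (g (y \<bullet> y)) \<partial>lborel)"
    by (rule nn_integral_cmult) measurable
  also have "(\<integral>\<^sup>+y. ennreal (?w y) * ennreal (g (y \<bullet> y)) \<partial>lborel) =
      ennreal ((\<Prod>i\<in>UNIV. sqrt pi * (fact (2 * k i) / (4 ^ k i * fact (k i)))) / Gamma p) *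
      (\<integral>\<^sup>+u. ennreal (indicator {0<..} u * u powr (p - 1)) * ennreal (g u) \<partial>lborel)"
    using nn_integral_monomial_radial[of "\<lambda>u. ennreal (g u)" k']
    by (simp add: prod_Basis_vec sum_Basis_vec k' p_def inner_axis)
  also have "ennreal K * (ennreal ((\<Prod>i\<in>UNIV. sqrt pi * (fact (2 * k i) / (4 ^ k i * fact (k i)))) / Gamma p) *
      (\<integral>\<^sup>+u. ennreal (indicator {0<..} u * u powr (p - 1)) * ennreal (g u) \<partial>lborel)) =
      ennreal (K * ((\<Prod>i\<in>UNIV. sqrt pi * (fact (2 * k i) / (4 ^ k i * fact (k i)))) / Gamma p)) *
      (\<integral>\<^sup>+u. ennreal (indicator {0<..} u * u powr (p - 1)) * ennreal (g u) \<partial>lborel)"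
    using K by (simp only: ennreal_mult' mult.assoc)
  also have "K * ((\<Prod>i\<in>UNIV. sqrt pi * (fact (2 * k i) / (4 ^ k i * fact (k i)))) / Gamma p) =
      K * sqrt pi ^ CARD('n) * (\<Prod>i\<in>UNIV. fact (2 * k i) / (4 ^ k i * fact (k i))) / Gamma p"
    unfolding prod.distrib[of "\<lambda>_. sqrt pi"] by simp
  finally show ?thesis .
qed

lemma borel_measurable_vec_component [measurable (raw)]:
  fixes X :: "'w \<Rightarrow> real^'n"
  assumes "X \<in> borel_measurable M"
  shows "(\<lambda>\<omega>. X \<omega> $ i) \<in> borel_measurable M"
proof (rule measurable_compose[OF assms])
  show "(\<lambda>x :: real^'n. x $ i) \<in> borel_measurable borel"
    by (intro borel_measurable_continuous_onI continuous_intros)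
qed

text \<open>\<open>Gamma p\<close> cancels between the spherical moment and the logistic integral.
  The unknown \<open>K\<close> and the power of \<open>sqrt pi\<close> are removed by dividing by
  the same formula with all exponents 0, which is the total mass.\<close>

lemma logistic_even_moment:
  fixes Y :: "'w \<Rightarrow> real^'n" and k :: "'n \<Rightarrow> nat" and a b r :: real
  assumes M: "prob_space M" and a: "a > 0" and b: "b > 0" and r: "r > 0"
    and Y: "distributed M lborel Y (\<lambda>y. ennreal (K * logistic_generator a b r (y \<bullet> y)))"
    and K: "K \<ge> 0"
  defines "n \<equiv> real CARD('n)" and "m \<equiv> \<Sum>i\<in>UNIV. k i"
  shows "has_bochner_integral M (\<lambda>\<omega>. \<Prod>i\<in>UNIV. (Y \<omega> $ i) ^ (2 * k i))
    (hurwitz_lerch_zeta r (- 1) (n / 2 + real m) (b / a) /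
      (a ^ m * hurwitz_lerch_zeta r (- 1) (n / 2) (b / a)) *
      (\<Prod>i\<in>UNIV. fact (2 * k i) / (4 ^ k i * fact (k i))))"
proof -
  interpret prob_space M by fact
  define Z where "Z p = hurwitz_lerch_zeta r (- 1) p (b / a)" for p
  define C where "C k = (\<Prod>i\<in>(UNIV::'n set). fact (2 * k i) / (4 ^ k i * fact (k i)) :: real)" for k
  define P where "P = sqrt pi ^ CARD('n)"
  have n: "n > 0" by (simp add: n_def)
  have Z0: "Z p \<ge> 0" if "p > 0" for p
    unfolding Z_def using a b r that by (intro hurwitz_lerch_zeta_nonneg) auto
  have C0: "C k > 0" for k unfolding C_def by (intro prod_pos) simp
  have nn: "(\<integral>\<^sup>+\<omega>. ennreal (\<Prod>i\<in>UNIV. (Y \<omega> $ i) ^ (2 * k i)) \<partial>M) =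
      ennreal (K * P * C k * Z (n / 2 + real (\<Sum>i\<in>UNIV. k i)) / a powr (n / 2 + real (\<Sum>i\<in>UNIV. k i)))"
    for k :: "'n \<Rightarrow> nat"
  proof -
    define p where "p = n / 2 + real (\<Sum>i\<in>UNIV. k i)"
    have p: "p > 0" using n unfolding p_def by (intro add_pos_nonneg of_nat_0_le_iff) simp_all
    have "logistic_generator a b r \<in> borel_measurable borel"
      unfolding logistic_generator_def[abs_def] by measurable
    moreover have "logistic_generator a b r u \<ge> 0" for u
      by (simp add: logistic_generator_def)
    ultimately have "(\<integral>\<^sup>+\<omega>. ennreal (\<Prod>i\<in>UNIV. (Y \<omega> $ i) ^ (2 * k i)) \<partial>M) =
        ennreal (K * P * C k / Gamma p) * ennreal (Gamma p * Z p / a powr p)"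
      using spherical_nn_even_moment[OF Y K, of k] nn_integral_logistic_generator[OF a b r p]
      by (simp add: C_def P_def Z_def p_def n_def)
    also have "\<dots> = ennreal (K * P * C k * Z p / a powr p)"
      using Gamma_real_pos[OF p] Z0[OF p] by (simp add: mult.assoc flip: ennreal_mult'')
    finally show ?thesis by (simp only: p_def)
  qed
  have one: "K * P * Z (n / 2) / a powr (n / 2) = 1"
  proof -
    have "(\<integral>\<^sup>+\<omega>. ennreal (\<Prod>i\<in>(UNIV::'n set). (Y \<omega> $ i) ^ (2 * 0)) \<partial>M) = 1"
      by (simp add: emeasure_space_1)
    moreover have "C (\<lambda>_. 0) = 1" by (simp add: C_def)
    ultimately have "ennreal (K * P * Z (n / 2) / a powr (n / 2)) = 1"
      using nn[of "\<lambda>_. 0"] by (simp only: sum.neutral_const of_nat_0 add_0_right mult_1_right)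
    then show ?thesis by (simp only: ennreal_eq_1)
  qed
  \<comment> \<open>A product equal to 1 has no zero factor, so no separate positivity estimate for
    the integral is needed.\<close>
  then have Zpos: "Z (n / 2) \<noteq> 0" by auto
  have Y_meas [measurable]: "Y \<in> M \<rightarrow>\<^sub>M borel"
    using distributed_measurable[OF Y] by simp
  define p where "p = n / 2 + real m"
  have p: "p > 0" using n unfolding p_def by (intro add_pos_nonneg of_nat_0_le_iff) simp_all
  have "K * P * C k * Z p / a powr p = Z p / (a ^ m * Z (n / 2)) * C k"
  proof -
    have "K * P = a powr (n / 2) / Z (n / 2)" using one Zpos a by (simp add: field_simps)
    moreover have "a powr p = a powr (n / 2) * a ^ m" using a by (simp add: p_def powr_add powr_realpow)
    ultimately show ?thesis using a by (simp add: field_simps)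
  qed
  then have "(\<integral>\<^sup>+\<omega>. ennreal (\<Prod>i\<in>UNIV. (Y \<omega> $ i) ^ (2 * k i)) \<partial>M) = ennreal (Z p / (a ^ m * Z (n / 2)) * C k)"
    unfolding nn by (simp add: p_def m_def)
  moreover have "(\<lambda>\<omega>. \<Prod>i\<in>UNIV. (Y \<omega> $ i) ^ (2 * k i)) \<in> borel_measurable M"
    by measurable
  ultimately have "has_bochner_integral M (\<lambda>\<omega>. \<Prod>i\<in>UNIV. (Y \<omega> $ i) ^ (2 * k i)) (Z p / (a ^ m * Z (n / 2)) * C k)"
    using Z0[OF p] Z0[of "n / 2"] n a C0[of k]
    by (intro has_bochner_integral_nn_integral) (auto simp: prod_nonneg less_imp_le)
  then show ?thesis by (simp add: Z_def C_def p_def)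
qed

text \<open>Sign changes preserve Lebesgue measure and the squared norm, so the reflected vector has
  the same density and hence the same law.\<close>

lemma spherical_sign_symmetry:
  fixes Y :: "'w \<Rightarrow> real^'n" and f :: "real^'n \<Rightarrow> real"
  assumes Y: "distributed M lborel Y (\<lambda>y. h (y \<bullet> y))"
    and h [measurable]: "h \<in> borel_measurable borel" and f [measurable]: "f \<in> borel_measurable borel"
    and c: "\<And>i. \<bar>c i\<bar> = 1"
  shows "(\<integral>\<omega>. f (\<chi> i. c i * Y \<omega> $ i) \<partial>M) = (\<integral>\<omega>. f (Y \<omega>) \<partial>M)"
proof -
  define T where "T y = (\<chi> i. c i * y $ i)" for y :: "real^'n"
  \<comment> \<open>The basis form of the reflection is the one in which its invariance of Lebesgue
    measure is available.\<close>
  have T: "T y = (\<Sum>j\<in>Basis. (c (THE i. j = axis i 1) * (y \<bullet> j)) *\<^sub>R j)" for y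
  proof -
    have "(THE j. axis i (1::real) = axis j 1) = i" for i :: 'n
      by (simp add: axis_eq_axis)
    then show ?thesis
      unfolding sum_Basis_vec by (simp add: T_def vec_eq_iff inner_axis) (simp add: axis_def if_distrib cong: if_cong)
  qed
  have TT: "T y \<bullet> T y = y \<bullet> y" for y
  proof -
    have "(c i * y $ i) * (c i * y $ i) = y $ i * y $ i" for i
    proof -
      have "c i * c i = 1"
        using c[of i] abs_mult_self_eq[of "c i"] by simp
      then show ?thesis by algebra
    qed
    then show ?thesis
      by (simp only: T_def inner_vec_def vec_lambda_beta inner_real_def)
  qed
  have [measurable]: "T \<in> borel_measurable borel"
    unfolding T[abs_def] by measurable
  have Y': "distributed M lborel (\<lambda>\<omega>. T (Y \<omega>)) (\<lambda>y. h (y \<bullet> y))"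
  proof (rule distributed_lborel_transform[OF Y])
    fix A :: "(real^'n) set" assume [measurable]: "A \<in> sets borel"
    show "(\<integral>\<^sup>+y. h (y \<bullet> y) * indicator A (T y) \<partial>lborel) = (\<integral>\<^sup>+y. h (y \<bullet> y) * indicator A y \<partial>lborel)"
      using nn_integral_lborel_signs[of "\<lambda>y. h (y \<bullet> y) * indicator A y" "\<lambda>j. c (THE i. j = axis i 1)"] c
      by (simp add: TT flip: T)
  qed measurable
  have [measurable]: "Y \<in> M \<rightarrow>\<^sub>M borel"
    using distributed_measurable[OF Y] by simp
  have "distr M lborel (\<lambda>\<omega>. T (Y \<omega>)) = distr M lborel Y"
    using distributed_distr_eq_density[OF Y] distributed_distr_eq_density[OF Y'] by simp
  then have "(\<integral>y. f y \<partial>(distr M lborel (\<lambda>\<omega>. T (Y \<omega>)))) = (\<integral>y. f y \<partial>(distr M lborel Y))"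
    by simp
  then have "(\<integral>\<omega>. f (T (Y \<omega>)) \<partial>M) = (\<integral>\<omega>. f (Y \<omega>) \<partial>M)"
    by (simp add: integral_distr)
  then show ?thesis
    by (simp only: T_def)
qed

lemma logistic_second_moments:
  fixes Y :: "'w \<Rightarrow> real^'n" and a b r :: real
  assumes M: "prob_space M" and a: "a > 0" and b: "b > 0" and r: "r > 0"
    and Y: "distributed M lborel Y (\<lambda>y. ennreal (K * logistic_generator a b r (y \<bullet> y)))"
    and K: "K \<ge> 0"
  defines "n \<equiv> real CARD('n)"
  shows "has_bochner_integral M Y 0"
    and "has_bochner_integral M (\<lambda>\<omega>. Y \<omega> $ i * Y \<omega> $ j)
      (if i = j then hurwitz_lerch_zeta r (- 1) (n / 2 + 1) (b / a) /
        (2 * a * hurwitz_lerch_zeta r (- 1) (n / 2) (b / a)) else 0)"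
proof -
  interpret prob_space M by fact
  have [measurable]: "Y \<in> M \<rightarrow>\<^sub>M borel"
    using distributed_measurable[OF Y] by simp
  have sq: "has_bochner_integral M (\<lambda>\<omega>. Y \<omega> $ i * Y \<omega> $ i)
      (hurwitz_lerch_zeta r (- 1) (n / 2 + 1) (b / a) /
        (2 * a * hurwitz_lerch_zeta r (- 1) (n / 2) (b / a)))" for i
  proof -
    let ?k = "\<lambda>j. if j = i then 1 else 0 :: nat"
    have "(\<Prod>j\<in>UNIV. (Y \<omega> $ j) ^ (2 * ?k j)) = Y \<omega> $ i * Y \<omega> $ i" for \<omega>
    proof -
      have "(\<Prod>j\<in>UNIV. (Y \<omega> $ j) ^ (2 * ?k j)) = (\<Prod>j\<in>UNIV. if j = i then Y \<omega> $ j * Y \<omega> $ j else 1)"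
        by (intro prod.cong) (auto simp: power2_eq_square)
      then show ?thesis by simp
    qed
    \<comment> \<open>The value 2! / (4 * 1!) = 1/2 is the origin of the 2 in the denominator of the
      covariance.\<close>
    moreover have "(\<Prod>j\<in>(UNIV::'n set). fact (2 * ?k j) / (4 ^ ?k j * fact (?k j))) = (1 / 2 :: real)"
    proof -
      have "(\<Prod>j\<in>(UNIV::'n set). fact (2 * ?k j) / (4 ^ ?k j * fact (?k j))) = (\<Prod>j\<in>(UNIV::'n set). if j = i then 1 / 2 else (1 :: real))"
        by (intro prod.cong) auto
      then show ?thesis by simp
    qed
    moreover have "(\<Sum>j\<in>UNIV. ?k j) = 1" by simp
    ultimately have "has_bochner_integral M (\<lambda>\<omega>. Y \<omega> $ i * Y \<omega> $ i)
        (hurwitz_lerch_zeta r (- 1) (n / 2 + real 1) (b / a) /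
          (a ^ 1 * hurwitz_lerch_zeta r (- 1) (n / 2) (b / a)) * (1 / 2))"
      using logistic_even_moment[OF M a b r Y K, of ?k] by (simp only: n_def)
    then show ?thesis by (simp add: mult_ac)
  qed
  have h: "(\<lambda>u. ennreal (K * logistic_generator a b r u)) \<in> borel_measurable borel"
    unfolding logistic_generator_def[abs_def] by measurable
  note sym = spherical_sign_symmetry[OF Y h]
  have int1: "integrable M (\<lambda>\<omega>. Y \<omega> $ i)" for i
  proof (rule Bochner_Integration.integrable_bound)
    show "integrable M (\<lambda>\<omega>. 1 + Y \<omega> $ i * Y \<omega> $ i)"
      using sq[of i] by (simp add: has_bochner_integral_iff)
    have "\<bar>x\<bar> \<le> 1 + x * x" for x :: real
      using zero_le_square[of "\<bar>x\<bar> - 1"] by (simp add: algebra_simps)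
    then show "AE \<omega> in M. norm (Y \<omega> $ i) \<le> norm (1 + Y \<omega> $ i * Y \<omega> $ i)"
      by (auto intro!: AE_I2)
  qed measurable
  \<comment> \<open>Reversing all signs shows that the integral equals its own negative.\<close>
  have zero1: "(\<integral>\<omega>. Y \<omega> $ i \<partial>M) = 0" for i
    using sym[of "\<lambda>y. y $ i" "\<lambda>_. -1"] by simp
  have expand: "y = (\<Sum>i\<in>UNIV. y $ i *\<^sub>R axis i 1)" for y :: "real^'n"
    using basis_expansion[of y] by (simp add: scalar_mult_eq_scaleR)
  have "has_bochner_integral M (\<lambda>\<omega>. \<Sum>i\<in>UNIV. Y \<omega> $ i *\<^sub>R (axis i 1 :: real^'n)) (\<Sum>i\<in>UNIV. 0 *\<^sub>R (axis i 1 :: real^'n))"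
    by (intro has_bochner_integral_sum has_bochner_integral_scaleR_left)
      (auto simp: has_bochner_integral_iff int1 zero1)
  then show "has_bochner_integral M Y 0"
    by (simp flip: expand)
  show "has_bochner_integral M (\<lambda>\<omega>. Y \<omega> $ i * Y \<omega> $ j)
      (if i = j then hurwitz_lerch_zeta r (- 1) (n / 2 + 1) (b / a) /
        (2 * a * hurwitz_lerch_zeta r (- 1) (n / 2) (b / a)) else 0)"
  proof (cases "i = j")
    case False
    have "integrable M (\<lambda>\<omega>. Y \<omega> $ i * Y \<omega> $ j)"
    proof (rule Bochner_Integration.integrable_bound)
      show "integrable M (\<lambda>\<omega>. Y \<omega> $ i * Y \<omega> $ i + Y \<omega> $ j * Y \<omega> $ j)"
        using sq[of i] sq[of j] by (simp add: has_bochner_integral_iff)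
      have "\<bar>x * y\<bar> \<le> x * x + y * y" for x y :: real
      proof -
        have "2 * (\<bar>x\<bar> * \<bar>y\<bar>) \<le> x * x + y * y"
          using zero_le_square[of "\<bar>x\<bar> - \<bar>y\<bar>"] by (simp add: algebra_simps)
        moreover have "0 \<le> \<bar>x\<bar> * \<bar>y\<bar>" by simp
        ultimately show ?thesis unfolding abs_mult by linarith
      qed
      then show "AE \<omega> in M. norm (Y \<omega> $ i * Y \<omega> $ j) \<le> norm (Y \<omega> $ i * Y \<omega> $ i + Y \<omega> $ j * Y \<omega> $ j)"
        by (auto intro!: AE_I2)
    qed measurable
    \<comment> \<open>Reversing coordinate \<open>i\<close> alone changes the sign of the product,
      because \<open>j\<close> differs from \<open>i\<close>.\<close>
    moreover have "(\<integral>\<omega>. Y \<omega> $ i * Y \<omega> $ j \<partial>M) = 0"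
      using sym[of "\<lambda>y. y $ i * y $ j" "\<lambda>l. if l = i then -1 else 1"] False by simp
    ultimately show ?thesis
      using False by (simp add: has_bochner_integral_iff)
  qed (use sq in simp)
qed

theorem theorem5p1:
  fixes M :: "'w measure" and X :: "'w \<Rightarrow> real^'n"
    and \<mu> :: "real^'n" and \<Sigma> :: "real^'n^'n" and a b r :: real
  assumes "prob_space M"
    and "a > 0" and "b > 0" and "r > 0"
    and "pos_def_matrix \<Sigma>"
    and "GML M X \<mu> \<Sigma> (logistic_generator a b r)"
  shows "(integrable M X \<and> integral\<^sup>L M X = \<mu>) \<and>
    ((\<forall>i j. integrable M (\<lambda>\<omega>. (X \<omega> $ i - \<mu> $ i) * (X \<omega> $ j - \<mu> $ j))) \<and>
     covariance_matrix M X =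
       (hurwitz_lerch_zeta r (- 1) (real CARD('n) / 2 + 1) (b / a) /
        (2 * a * hurwitz_lerch_zeta r (- 1) (real CARD('n) / 2) (b / a))) *\<^sub>R \<Sigma>) \<and>
    (\<forall>k :: 'n \<Rightarrow> nat.
       let m = (\<Sum>i\<in>UNIV. k i);
           n = real CARD('n);
           Y = (\<lambda>\<omega>. matrix_inv (matrix_sqrt \<Sigma>) *v (X \<omega> - \<mu>))
       in integrable M (\<lambda>\<omega>. \<Prod>i\<in>UNIV. (Y \<omega> $ i) ^ (2 * k i)) \<and>
          (\<integral>\<omega>. (\<Prod>i\<in>UNIV. (Y \<omega> $ i) ^ (2 * k i)) \<partial>M) =
            (1 / a) ^ m * Gamma (n / 2 + real m) *
              hurwitz_lerch_zeta r (- 1) (n / 2 + real m) (b / a) /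
            (pochhammer (n / 2) m * Gamma (n / 2) *
              hurwitz_lerch_zeta r (- 1) (n / 2) (b / a)) *
            (\<Prod>i\<in>UNIV. fact (2 * k i) / (4 ^ k i * fact (k i))))"
proof -
  interpret prob_space M by fact
  define S where "S = matrix_sqrt \<Sigma>"
  define Y where "Y \<omega> = matrix_inv S *v (X \<omega> - \<mu>)" for \<omega>
  define v where "v = hurwitz_lerch_zeta r (- 1) (real CARD('n) / 2 + 1) (b / a) /
    (2 * a * hurwitz_lerch_zeta r (- 1) (real CARD('n) / 2) (b / a))"
  have S: "pos_def_matrix S" "S ** S = \<Sigma>"
    using matrix_sqrt[OF assms(5)] by (simp_all add: S_def)
  have "logistic_generator a b r \<in> borel_measurable borel"
    unfolding logistic_generator_def[abs_def] by measurable
  moreover have "logistic_generator a b r u \<ge> 0" for u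
    by (simp add: logistic_generator_def)
  ultimately obtain K where K: "K \<ge> 0"
    and dist: "distributed M lborel Y (\<lambda>y. ennreal (K * logistic_generator a b r (y \<bullet> y)))"
    using GML_standardized[OF assms(5,6)] unfolding Y_def S_def by blast
  have SY: "S *v Y \<omega> = X \<omega> - \<mu>" for \<omega>
    using matrix_inverse(1)[OF pos_def_invertible[OF S(1)]]
    by (simp add: Y_def matrix_vector_mul_assoc)
  have mean_Y: "has_bochner_integral M Y 0"
    and cov_Y: "\<And>i j. has_bochner_integral M (\<lambda>\<omega>. Y \<omega> $ i * Y \<omega> $ j) (if i = j then v else 0)"
    unfolding v_def by (rule logistic_second_moments[OF assms(1-4) dist K])+
  have "has_bochner_integral M (\<lambda>\<omega>. \<mu> + S *v Y \<omega>) (\<mu> + S *v 0)"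
    using mean_Y prob_space
    by (intro has_bochner_integral_add has_bochner_integral_bounded_linear[OF matrix_vector_mul_bounded_linear])
      (auto simp: has_bochner_integral_iff)
  then have mean_X: "has_bochner_integral M X \<mu>"
    by (simp add: SY)
  \<comment> \<open>\<open>covariance_matrix\<close> centres every component by its own integral, so
    the vector mean has to be read off componentwise.\<close>
  then have mean_Xi: "(\<integral>\<omega>. X \<omega> $ i \<partial>M) = \<mu> $ i" for i
    using integral_bounded_linear[OF bounded_linear_vec_nth[of i], of M X]
    by (simp add: has_bochner_integral_iff)
  have cov_X: "has_bochner_integral M (\<lambda>\<omega>. (X \<omega> $ i - \<mu> $ i) * (X \<omega> $ j - \<mu> $ j)) (v * \<Sigma> $ i $ j)" for i j
  proof -
    have "X \<omega> $ i - \<mu> $ i = (\<Sum>k\<in>UNIV. S $ i $ k * Y \<omega> $ k)" for \<omega> i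
      using SY[of \<omega>] by (simp add: vec_eq_iff matrix_vector_mult_def)
    then have "(X \<omega> $ i - \<mu> $ i) * (X \<omega> $ j - \<mu> $ j) =
        (\<Sum>k\<in>UNIV. \<Sum>l\<in>UNIV. (S $ i $ k * S $ j $ l) * (Y \<omega> $ k * Y \<omega> $ l))" for \<omega>
      by (simp add: sum_product mult_ac)
    moreover have "has_bochner_integral M
        (\<lambda>\<omega>. \<Sum>k\<in>UNIV. \<Sum>l\<in>UNIV. (S $ i $ k * S $ j $ l) * (Y \<omega> $ k * Y \<omega> $ l))
        (\<Sum>k\<in>UNIV. \<Sum>l\<in>UNIV. (S $ i $ k * S $ j $ l) * (if k = l then v else 0))"
      by (intro has_bochner_integral_sum has_bochner_integral_mult_right cov_Y)
    moreover have "(\<Sum>k\<in>UNIV. \<Sum>l\<in>UNIV. (S $ i $ k * S $ j $ l) * (if k = l then v else 0)) = v * \<Sigma> $ i $ j"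
    proof -
      \<comment> \<open>Only the terms with \<open>k = l\<close> survive, leaving \<open>v\<close>
        times an entry of S times its transpose; symmetry turns this into an entry of
        \<open>S ** S\<close>.\<close>
      have "transpose S = S"
        using S(1) by (simp add: pos_def_matrix_def)
      then have "S $ j $ k = S $ k $ j" for k
        by (metis transpose_def vec_lambda_beta)
      then have "(\<Sum>l\<in>UNIV. (S $ i $ k * S $ j $ l) * (if k = l then v else 0)) = v * (S $ i $ k * S $ k $ j)" for k
        by (simp add: if_distrib cong: if_cong)
      then show ?thesis
        by (simp add: matrix_matrix_mult_def sum_distrib_left flip: S(2))
    qed
    ultimately show ?thesis by simp
  qed
  have "covariance_matrix M X = v *\<^sub>R \<Sigma>"
    using has_bochner_integral_integral_eq[OF cov_X]
    by (simp add: covariance_matrix_def vec_eq_iff mean_Xi)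
  moreover have "integrable M (\<lambda>\<omega>. \<Prod>i\<in>UNIV. (Y \<omega> $ i) ^ (2 * k i)) \<and>
      (\<integral>\<omega>. (\<Prod>i\<in>UNIV. (Y \<omega> $ i) ^ (2 * k i)) \<partial>M) =
        (1 / a) ^ m * Gamma (n / 2 + real m) *
          hurwitz_lerch_zeta r (- 1) (n / 2 + real m) (b / a) /
        (pochhammer (n / 2) m * Gamma (n / 2) *
          hurwitz_lerch_zeta r (- 1) (n / 2) (b / a)) *
        (\<Prod>i\<in>UNIV. fact (2 * k i) / (4 ^ k i * fact (k i)))"
    if n: "n = real CARD('n)" and m: "m = (\<Sum>i\<in>UNIV. k i)" for k :: "'n \<Rightarrow> nat" and m n
  proof -
    have "n / 2 > 0" by (simp add: n)
    then have "n / 2 \<notin> \<int>\<^sub>\<le>\<^sub>0" by (auto elim!: nonpos_Ints_cases)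
    \<comment> \<open>The Gamma factors of the stated moment thus cancel, and the quotient of zeta
      values already computed remains.\<close>
    then have G: "pochhammer (n / 2) m * Gamma (n / 2) = Gamma (n / 2 + real m)"
      using Gamma_real_pos[OF \<open>n / 2 > 0\<close>] by (simp add: pochhammer_Gamma)
    have "Gamma (n / 2 + real m) > 0"
      using \<open>n / 2 > 0\<close> by (intro Gamma_real_pos add_pos_nonneg) simp_all
    then have eq: "(1 / a) ^ m * Gamma (n / 2 + real m) *
          hurwitz_lerch_zeta r (- 1) (n / 2 + real m) (b / a) /
        (Gamma (n / 2 + real m) * hurwitz_lerch_zeta r (- 1) (n / 2) (b / a)) =
        hurwitz_lerch_zeta r (- 1) (n / 2 + real m) (b / a) / (a ^ m * hurwitz_lerch_zeta r (- 1) (n / 2) (b / a))"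
      by (simp add: power_divide)
    show ?thesis
      using logistic_even_moment[OF assms(1-4) dist K, of k, folded n m]
      unfolding G eq has_bochner_integral_iff .
  qed
  ultimately show ?thesis
    using mean_X cov_X unfolding Let_def Y_def S_def v_def
    by (auto simp: has_bochner_integral_iff)
qed

end
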